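(* Let $N\ge 1$, let $x$ be a complex parameter, and let $P$ be an element of the compact symplectic group $Sp(2N)$ (matrices of size $2N\times 2N$). Then $$\exp(x\,\mathrm{Tr}\,P)=\sum_{n_1\ge n_2\ge\cdots\ge n_N\ge 0}\det\left[I_{n_j+i-j}(2x)-I_{n_j+2N+2-i-j}(2x)\right]\chi_{(n_1,\dots,n_N)}(P),$$ where the determinant is of the $N\times N$ matrix with the displayed entry in row $i$ and column $j$.
   Context: $I_\lambda$ is the modified Bessel function: for integers $\lambda\ge 0$, $I_\lambda(x)=\sum_{p=0}^{\infty}\frac{1}{p!(p+\lambda)!}\left(\frac{x}{2}\right)^{2p+\lambda}$, and $I_{-\lambda}=I_\lambda$. The eigenvalues of $P$ are $t_1,\dots,t_N,t_1^{-1},\dots,t_N^{-1}$ with $|t_i|=1$. For integers $n_1\ge\cdots\ge n_N\ge 0$, $\chi_{(n_1,\dots,n_N)}$ is the irreducible character of $Sp(2N)$ given by the Weyl formula $$\chi_{(n_1,\dots,n_N)}(P)=\frac{\det\left[t_i^{n_j+N-j+1}-t_i^{-(n_j+N-j+1)}\right]}{\det\left[t_i^{N+1-j}-t_i^{-(N+1-j)}\right]}$$ ($N\times N$ determinants, row $i$, column $j$; the ratio is a Laurent polynomial in the $t_i$, and is interpreted as such where the denominator vanishes). The sum runs over all integer tuples $n_1\ge\cdots\ge n_N\ge 0$. *)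

theory Defs
  imports
    "HOL-Analysis.Infinite_Sum"
    "HOL-Library.Poly_Mapping"
    "Jordan_Normal_Form.Char_Poly"
    "Jordan_Normal_Form.Schur_Decomposition"
begin

text \<open>Rows, columns and variables are indexed from \<open>0\<close>: the variable \<open>t\<^sub>i\<close>
  of the mathematical text is \<open>t (i - 1)\<close>, and an index tuple
  \<open>n\<^sub>1 \<ge> \<dots> \<ge> n\<^sub>N \<ge> 0\<close> is a list of length \<open>N\<close> with \<open>n\<^sub>j = n ! (j - 1)\<close>.\<close>

definition bessel_I :: "int \<Rightarrow> complex \<Rightarrow> complex" where
  "bessel_I k x =
     suminf (\<lambda>p. 1 / (fact p * fact (p + nat \<bar>k\<bar>)) * (x / 2) ^ (2 * p + nat \<bar>k\<bar>))"

definition symplectic_form :: "nat \<Rightarrow> complex mat" where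
  "symplectic_form N =
     four_block_mat (0\<^sub>m N N) (1\<^sub>m N) (- 1\<^sub>m N) (0\<^sub>m N N)"

definition compact_symplectic_group :: "nat \<Rightarrow> complex mat set" where
  "compact_symplectic_group N =
     {P \<in> carrier_mat (2 * N) (2 * N).
        mat_adjoint P * P = 1\<^sub>m (2 * N) \<and>
        transpose_mat P * symplectic_form N * P = symplectic_form N}"

definition mat_trace :: "'a :: comm_monoid_add mat \<Rightarrow> 'a" where
  "mat_trace A = (\<Sum>i<dim_row A. A $$ (i, i))"

definition symplectic_eigenvalues :: "nat \<Rightarrow> complex mat \<Rightarrow> (nat \<Rightarrow> complex) \<Rightarrow> bool" where
  "symplectic_eigenvalues N P t \<longleftrightarrow>
     (\<forall>i<N. cmod (t i) = 1) \<and>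
     char_poly P = (\<Prod>i<N. [:- t i, 1:] * [:- inverse (t i), 1:])"

text \<open>Laurent polynomials form the group algebra of the exponent group; the
  product of poly mappings is convolution.\<close>

type_synonym laurent_poly = "(nat \<Rightarrow>\<^sub>0 int) \<Rightarrow>\<^sub>0 complex"

definition laurent_var_power :: "nat \<Rightarrow> int \<Rightarrow> laurent_poly" where
  "laurent_var_power i k = Poly_Mapping.single (Poly_Mapping.single i k) 1"

definition laurent_eval :: "laurent_poly \<Rightarrow> (nat \<Rightarrow> complex) \<Rightarrow> complex" where
  "laurent_eval q t =
     (\<Sum>e \<in> Poly_Mapping.keys q. Poly_Mapping.lookup q e *
        (\<Prod>i \<in> Poly_Mapping.keys e. t i powi Poly_Mapping.lookup e i))"

definition weyl_numerator :: "nat \<Rightarrow> nat list \<Rightarrow> laurent_poly" where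
  "weyl_numerator N n =
     Determinant.det (Matrix.mat N N (\<lambda>(i, j).
        laurent_var_power i (int (n ! j) + int N - int j)
        - laurent_var_power i (- (int (n ! j) + int N - int j))))"

definition weyl_denominator :: "nat \<Rightarrow> laurent_poly" where
  "weyl_denominator N =
     Determinant.det (Matrix.mat N N (\<lambda>(i, j).
        laurent_var_power i (int N - int j)
        - laurent_var_power i (- (int N - int j))))"

text \<open>The quotient is taken in the ring of Laurent polynomials, which is an
  integral domain, and only then evaluated; so the value is meaningful also where
  the denominator vanishes.\<close>

definition weyl_character_poly :: "nat \<Rightarrow> nat list \<Rightarrow> laurent_poly" where
  "weyl_character_poly N n = (THE q. q * weyl_denominator N = weyl_numerator N n)"

text \<open>The \<open>t\<^sub>i\<close> are determined by \<open>P\<close> only up to permutation and inversion, under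
  which the character polynomial is invariant; hence any choice may be taken.\<close>

definition symplectic_character :: "nat \<Rightarrow> nat list \<Rightarrow> complex mat \<Rightarrow> complex" where
  "symplectic_character N n P =
     laurent_eval (weyl_character_poly N n) (SOME t. symplectic_eigenvalues N P t)"

definition dominant_weights :: "nat \<Rightarrow> nat list set" where
  "dominant_weights N = {n. length n = N \<and> sorted_wrt (\<ge>) n}"

end

theory Submission
  imports Defs "HOL-Analysis.Elementary_Metric_Spaces"
begin

text \<open>Put \<open>y\<^sub>i = t\<^sub>i + 1/t\<^sub>i\<close> and let \<open>J\<close> be the bidiagonal \<open>N \<times> N\<close> matrix with diagonal
  \<open>y\<close> and ones above it. The recurrence \<open>v(0) = 0\<close>, \<open>v(1) = e\<^sub>N\<close>, \<open>v(m+1) = J v(m) - v(m-1)\<close>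
  produces the divided differences of the Chebyshev polynomials \<open>(t^m - t^-m)/(t - 1/t)\<close> in
  \<open>t + 1/t\<close>. By Newton interpolation the character is the determinant with columns \<open>v(\<mu>\<^sub>j)\<close>,
  \<open>\<mu>\<^sub>j = n\<^sub>j + N - j + 1\<close>; this has no denominator and makes sense also when some \<open>y\<^sub>i\<close> coincide.
  Extend \<open>v\<close> to an odd function on the integers. Then \<open>J v(m) = v(m+1) + v(m-1)\<close>, and regrouping
  the exponential series gives
  \<open>exp(xJ) v(\<nu>) = \<Sum>m\<ge>1. (I(m-\<nu>) - I(m+\<nu>)) v(m)\<close> with Bessel functions taken at \<open>2x\<close>. For
  \<open>\<nu> = N, \<dots>, 1\<close> the determinant of the left sides is \<open>det exp(xJ) = exp(x \<Sum> y\<^sub>i)\<close>, and the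
  Cauchy-Binet formula expands that of the right sides into the sum over dominant weights.

  That the eigenvalues of \<open>P\<close> come in pairs \<open>t\<^sub>i, 1/t\<^sub>i\<close>, with even multiplicity at \<open>1\<close> and
  \<open>-1\<close>, follows by building an orthonormal eigenbasis that is stable under \<open>v \<mapsto> \<Omega> (conj v)\<close>.\<close>

section \<open>Divided differences of Chebyshev polynomials\<close>

text \<open>\<open>newton_op y\<close> is the matrix \<open>J\<close> and \<open>cheb_diff N y m\<close> the vector \<open>v(m)\<close>. Vectors are
  functions on all of \<open>nat\<close> that vanish from \<open>N\<close> on, so \<open>newton_op\<close> need not know \<open>N\<close>.\<close>

definition newton_op :: "(nat \<Rightarrow> 'a :: comm_ring_1) \<Rightarrow> (nat \<Rightarrow> 'a) \<Rightarrow> nat \<Rightarrow> 'a" where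
  "newton_op y w = (\<lambda>i. y i * w i + w (Suc i))"

fun cheb_diff :: "nat \<Rightarrow> (nat \<Rightarrow> 'a :: comm_ring_1) \<Rightarrow> nat \<Rightarrow> nat \<Rightarrow> 'a" where
  "cheb_diff N y 0 = (\<lambda>i. 0)"
| "cheb_diff N y (Suc 0) = (\<lambda>i. if Suc i = N then 1 else 0)"
| "cheb_diff N y (Suc (Suc m)) =
     (\<lambda>i. newton_op y (cheb_diff N y (Suc m)) i - cheb_diff N y m i)"

lemma cheb_diff_outside: "N \<le> i \<Longrightarrow> cheb_diff N y m i = 0"
  by (induction N y m arbitrary: i rule: cheb_diff.induct) (auto simp: newton_op_def)

text \<open>\<open>newton_op\<close> moves the support of a vector down by at most one index, and
  the recurrence starts from the unit vector at index \<open>N - 1\<close>.\<close>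

lemma cheb_diff_below: "i + m < N \<Longrightarrow> cheb_diff N y m i = 0"
  by (induction N y m arbitrary: i rule: cheb_diff.induct) (auto simp: newton_op_def)

lemma cheb_diff_leading: "0 < m \<Longrightarrow> i + m = N \<Longrightarrow> cheb_diff N y m i = 1"
proof (induction N y m arbitrary: i rule: cheb_diff.induct)
  case (3 N y m)
  have "cheb_diff N y (Suc m) i = 0" "cheb_diff N y m i = 0"
    using 3(4) by (auto intro!: cheb_diff_below)
  moreover have "cheb_diff N y (Suc m) (Suc i) = 1"
    using 3 by auto
  ultimately show ?case by (simp add: newton_op_def)
qed auto

text \<open>With \<open>y i\<close> = t_i + 1/t_i this is a Weyl character written without a
  denominator, where \<open>m\<close> is the weight shifted by the staircase; see
  \<open>weyl_character_poly_eq\<close>.\<close>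

definition chi_det :: "nat \<Rightarrow> (nat \<Rightarrow> 'a :: comm_ring_1) \<Rightarrow> (nat \<Rightarrow> nat) \<Rightarrow> 'a" where
  "chi_det N y m = Determinant.det (Matrix.mat N N (\<lambda>(i, j). cheb_diff N y (m j) i))"

text \<open>The matrix is lower triangular with unit diagonal. The fact serves twice: it makes the
  Weyl denominator equal to the prefactor in \<open>det_powers_factor\<close>, and it leaves exactly
  \<open>det exp(xJ)\<close> on the summed side of Cauchy-Binet.\<close>

lemma chi_det_staircase: "chi_det N y (\<lambda>j. N - j) = 1"
proof -
  let ?M = "Matrix.mat N N (\<lambda>(i, j). cheb_diff N y (N - j) i)"
  have "Determinant.det ?M = prod_list (diag_mat ?M)"
    by (rule det_lower_triangular[where n = N]) (auto intro!: cheb_diff_below)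
  also have "diag_mat ?M = map (\<lambda>i. 1) [0..<N]"
    by (auto simp: diag_mat_def intro!: cheb_diff_leading)
  also have "prod_list \<dots> = (1::'a)" by (induction N) auto
  finally show ?thesis by (simp add: chi_det_def)
qed

section \<open>Newton interpolation and determinants of powers\<close>

text \<open>The Newton basis polynomials for the nodes \<open>y (N - 1)\<close>, ...,
  \<open>y (k + 1)\<close>, evaluated at \<open>y i\<close>.\<close>

definition newton_coeff :: "nat \<Rightarrow> (nat \<Rightarrow> 'a :: comm_ring_1) \<Rightarrow> nat \<Rightarrow> nat \<Rightarrow> 'a" where
  "newton_coeff N y i k = (\<Prod>l\<in>{Suc k..<N}. y i - y l)"

lemma newton_coeff_below: "k < i \<Longrightarrow> i < N \<Longrightarrow> newton_coeff N y i k = 0"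
  unfolding newton_coeff_def by (rule prod_zero[of _ ]) auto

lemma newton_coeff_Suc:
  "Suc k < N \<Longrightarrow> newton_coeff N y i k = (y i - y (Suc k)) * newton_coeff N y i (Suc k)"
  unfolding newton_coeff_def by (subst prod.atLeast_Suc_lessThan) auto

text \<open>The rows of Newton coefficients are left eigenvectors of \<open>J\<close>.\<close>

lemma newton_coeff_eigen:
  assumes "i < N" "\<And>k. N \<le> k \<Longrightarrow> w k = 0"
  shows "(\<Sum>k<N. newton_coeff N y i k * newton_op y w k) = y i * (\<Sum>k<N. newton_coeff N y i k * w k)"
proof -
  obtain M where M: "N = Suc M" using assms(1) by (cases N) auto
  \<comment> \<open>The index shift below leaves out the term at index 0. That term is zero, so the
    sum can be completed to all of \<open>{..<N}\<close>.\<close>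
  have z: "(y i - y 0) * newton_coeff N y i 0 = 0"
  proof (cases "i = 0")
    case False
    then show ?thesis using newton_coeff_below[of 0 i N y] assms(1) by simp
  qed simp
  have "(\<Sum>k<N. newton_coeff N y i k * w (Suc k)) = (\<Sum>k<M. newton_coeff N y i k * w (Suc k))"
    by (simp add: M assms(2))
  also have "\<dots> = (\<Sum>k<M. (y i - y (Suc k)) * newton_coeff N y i (Suc k) * w (Suc k))"
    by (rule sum.cong) (auto simp: newton_coeff_Suc M)
  also have "\<dots> = (\<Sum>k<N. (y i - y k) * newton_coeff N y i k * w k)"
    unfolding M sum.lessThan_Suc_shift using z M by simp
  finally have *: "(\<Sum>k<N. newton_coeff N y i k * w (Suc k)) =
      (\<Sum>k<N. (y i - y k) * newton_coeff N y i k * w k)" .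
  have "(\<Sum>k<N. newton_coeff N y i k * newton_op y w k) =
      (\<Sum>k<N. newton_coeff N y i k * (y k * w k)) + (\<Sum>k<N. newton_coeff N y i k * w (Suc k))"
    by (simp add: newton_op_def sum.distrib algebra_simps)
  also have "\<dots> = (\<Sum>k<N. y i * (newton_coeff N y i k * w k))"
    unfolding * sum.distrib[symmetric] by (rule sum.cong) (auto simp: algebra_simps)
  finally show ?thesis by (simp add: sum_distrib_left)
qed

text \<open>By \<open>newton_coeff_eigen\<close>, pairing \<open>cheb_diff\<close> with a row of
  Newton coefficients gives the scalar recurrence S(m+2) = y_i S(m+1) - S(m) with S(0) = 0, S(1) =
  1. Multiplying by \<open>t i - u i\<close> instead of dividing the right side by it keeps the
  identity valid in every commutative ring.\<close>

lemma newton_expansion: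
  fixes t u :: "nat \<Rightarrow> 'a :: comm_ring_1"
  assumes "i < N" "t i * u i = 1"
  defines "y \<equiv> (\<lambda>i. t i + u i)"
  shows "(\<Sum>k<N. (t i - u i) * newton_coeff N y i k * cheb_diff N y m k) = t i ^ m - u i ^ m"
proof -
  define S where "S m = (\<Sum>k<N. newton_coeff N y i k * cheb_diff N y m k)" for m
  have S0: "S 0 = 0" by (simp add: S_def)
  have "S 1 = (\<Sum>k<N. if k = N - 1 then newton_coeff N y i k else 0)"
    unfolding S_def using assms(1) by (intro sum.cong) auto
  also have "\<dots> = 1" using assms(1) by (simp add: newton_coeff_def)
  finally have S1: "S (Suc 0) = 1" by simp
  have S2: "S (Suc (Suc m)) = y i * S (Suc m) - S m" for m
    unfolding S_def
    by (simp add: algebra_simps sum_subtractf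
        newton_coeff_eigen[OF assms(1) cheb_diff_outside, simplified algebra_simps])
  have ut: "t i * t i ^ n * u i = t i ^ n" "u i * u i ^ n * t i = u i ^ n" for n
  proof -
    have "t i * t i ^ n * u i = (t i * u i) * t i ^ n" by (simp only: ac_simps)
    then show "t i * t i ^ n * u i = t i ^ n" using assms(2) by simp
    have "u i * u i ^ n * t i = (t i * u i) * u i ^ n" by (simp only: ac_simps)
    then show "u i * u i ^ n * t i = u i ^ n" using assms(2) by simp
  qed
  have "(t i - u i) * S m = t i ^ m - u i ^ m \<and> (t i - u i) * S (Suc m) = t i ^ Suc m - u i ^ Suc m"
  proof (induction m)
    case (Suc m)
    have "(t i - u i) * S (Suc (Suc m)) = y i * ((t i - u i) * S (Suc m)) - (t i - u i) * S m"
      by (simp add: S2 algebra_simps)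
    also have "\<dots> = (t i + u i) * (t i ^ Suc m - u i ^ Suc m) - (t i ^ m - u i ^ m)"
      using Suc by (simp only: y_def)
    also have "\<dots> = t i ^ Suc (Suc m) - u i ^ Suc (Suc m)
        + (t i * t i ^ m * u i - t i ^ m) - (u i * u i ^ m * t i - u i ^ m)"
      by (simp add: algebra_simps)
    also have "\<dots> = t i ^ Suc (Suc m) - u i ^ Suc (Suc m)"
      by (simp add: ut)
    finally show ?case using Suc by simp
  qed (simp add: S0 S1)
  then show ?thesis by (simp add: S_def sum_distrib_left mult.assoc)
qed

text \<open>The matrix is the triangular matrix of Newton coefficients, rows scaled by
  \<open>t i - u i\<close>, times the matrix of \<open>chi_det\<close>. The prefactor is independent
  of \<open>m\<close> and therefore cancels in the Weyl quotient.\<close>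

lemma det_powers_factor:
  fixes t u :: "nat \<Rightarrow> 'a :: comm_ring_1"
  assumes "\<And>i. i < N \<Longrightarrow> t i * u i = 1"
  defines "y \<equiv> (\<lambda>i. t i + u i)"
  shows "Determinant.det (Matrix.mat N N (\<lambda>(i, j). t i ^ m j - u i ^ m j)) =
    (\<Prod>i<N. (t i - u i) * newton_coeff N y i i) * chi_det N y m"
proof -
  let ?A = "Matrix.mat N N (\<lambda>(i, k). (t i - u i) * newton_coeff N y i k)"
  let ?V = "Matrix.mat N N (\<lambda>(k, j). cheb_diff N y (m j) k)"
  have "Matrix.mat N N (\<lambda>(i, j). t i ^ m j - u i ^ m j) = ?A * ?V"
    by (rule eq_matI)
      (auto simp: scalar_prod_def y_def atLeast0LessThan assms(1)
        newton_expansion[of _ N t u, symmetric])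
  then have "Determinant.det (Matrix.mat N N (\<lambda>(i, j). t i ^ m j - u i ^ m j)) =
      Determinant.det ?A * Determinant.det ?V"
    using det_mult[of ?A N ?V] by simp
  also have "Determinant.det ?A = prod_list (diag_mat ?A)"
    by (rule det_upper_triangular[where n = N]) (auto simp: newton_coeff_below upper_triangular_def)
  also have "\<dots> = (\<Prod>i<N. (t i - u i) * newton_coeff N y i i)"
    by (simp add: diag_mat_def prod.list_conv_set_nth atLeast0LessThan)
  finally show ?thesis by (simp add: chi_det_def)
qed

section \<open>Evaluation of Laurent polynomials\<close>

lemma laurent_var_power_add:
  "laurent_var_power i (k + l) = laurent_var_power i k * laurent_var_power i l"
  by (simp add: laurent_var_power_def Poly_Mapping.mult_single Poly_Mapping.single_add)

lemma laurent_var_power_0: "laurent_var_power i 0 = 1"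
  by (simp add: laurent_var_power_def)

lemma laurent_var_power_of_nat:
  "laurent_var_power i (int m) = laurent_var_power i 1 ^ m"
  "laurent_var_power i (- int m) = laurent_var_power i (- 1) ^ m"
proof -
  show "laurent_var_power i (int m) = laurent_var_power i 1 ^ m"
    by (induction m) (simp_all add: laurent_var_power_0 laurent_var_power_add)
  show "laurent_var_power i (- int m) = laurent_var_power i (- 1) ^ m"
  proof (induction m)
    case (Suc m)
    have "laurent_var_power i (- int (Suc m)) = laurent_var_power i (- 1 + - int m)" by simp
    then show ?case by (simp only: laurent_var_power_add Suc power_Suc)
  qed (simp add: laurent_var_power_0)
qed

lemma single_var_power_eq_iff:
  "(Poly_Mapping.single i k :: nat \<Rightarrow>\<^sub>0 int) = Poly_Mapping.single j l \<longleftrightarrow> i = j \<and> k = l \<or> k = 0 \<and> l = 0"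
proof
  assume *: "(Poly_Mapping.single i k :: nat \<Rightarrow>\<^sub>0 int) = Poly_Mapping.single j l"
  then have "Poly_Mapping.lookup (Poly_Mapping.single i k) i = Poly_Mapping.lookup (Poly_Mapping.single j l) i"
    and "Poly_Mapping.lookup (Poly_Mapping.single i k) j = Poly_Mapping.lookup (Poly_Mapping.single j l) j" by simp_all
  then show "i = j \<and> k = l \<or> k = 0 \<and> l = 0"
    by (auto simp: lookup_single when_def split: if_splits)
qed auto

lemma lookup_laurent_var_power:
  "Poly_Mapping.lookup (laurent_var_power i k) (Poly_Mapping.single j l) =
     (if i = j \<and> k = l \<or> k = 0 \<and> l = 0 then 1 else 0)"
  by (auto simp: laurent_var_power_def lookup_single when_def single_var_power_eq_iff)

text \<open>The coefficient of the monomial t_i is one. Together with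
  \<open>laurent_trace_diff_nonzero\<close> this shows that every factor of the Weyl denominator is
  nonzero.\<close>

lemma laurent_var_diff_inverse_nonzero:
  "laurent_var_power i 1 - laurent_var_power i (- 1) \<noteq> 0"
proof
  assume "laurent_var_power i 1 - laurent_var_power i (- 1) = 0"
  then have "Poly_Mapping.lookup (laurent_var_power i 1 - laurent_var_power i (- 1)) (Poly_Mapping.single i 1) = 0"
    by simp
  then show False by (simp add: lookup_minus lookup_laurent_var_power)
qed

lemma laurent_trace_diff_nonzero:
  assumes "i \<noteq> j"
  shows "(laurent_var_power i 1 + laurent_var_power i (- 1))
    - (laurent_var_power j 1 + laurent_var_power j (- 1)) \<noteq> 0" (is "?p \<noteq> 0")
proof
  assume "?p = 0"
  then have "Poly_Mapping.lookup ?p (Poly_Mapping.single i 1) = 0" by simp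
  then show False using assms by (simp add: lookup_minus lookup_add lookup_laurent_var_power)
qed

section \<open>Evaluation as a ring homomorphism\<close>

lemma laurent_eval_superset:
  assumes "finite S" "Poly_Mapping.keys q \<subseteq> S"
  shows "laurent_eval q t =
     (\<Sum>e\<in>S. Poly_Mapping.lookup q e * (\<Prod>i \<in> Poly_Mapping.keys e. t i powi Poly_Mapping.lookup e i))"
  unfolding laurent_eval_def
  by (rule sum.mono_neutral_left) (use assms in \<open>auto simp: not_in_keys_iff_lookup_eq_zero\<close>)

lemma laurent_eval_add: "laurent_eval (p + q) t = laurent_eval p t + laurent_eval q t"
proof -
  let ?S = "Poly_Mapping.keys p \<union> Poly_Mapping.keys q"
  have "Poly_Mapping.keys (p + q) \<subseteq> ?S" by (rule Poly_Mapping.keys_add)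
  then show ?thesis
    by (simp add: laurent_eval_superset[of ?S] lookup_add sum.distrib algebra_simps)
qed

lemma laurent_eval_zero: "laurent_eval 0 t = 0"
  by (simp add: laurent_eval_def)

lemma laurent_eval_sum: "laurent_eval (sum f A) t = (\<Sum>a\<in>A. laurent_eval (f a) t)"
  by (induction A rule: infinite_finite_induct) (simp_all add: laurent_eval_zero laurent_eval_add)

lemma laurent_eval_single:
  "laurent_eval (Poly_Mapping.single e c) t =
     c * (\<Prod>i \<in> Poly_Mapping.keys e. t i powi Poly_Mapping.lookup e i)"
  by (subst laurent_eval_superset[of "{e}"]) auto

lemma prod_powi_superset:
  fixes t :: "nat \<Rightarrow> complex"
  assumes "finite S" "Poly_Mapping.keys e \<subseteq> S"
  shows "(\<Prod>i \<in> Poly_Mapping.keys e. t i powi Poly_Mapping.lookup e i) = (\<Prod>i\<in>S. t i powi Poly_Mapping.lookup e i)"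
  by (rule prod.mono_neutral_left) (use assms in \<open>auto simp: not_in_keys_iff_lookup_eq_zero\<close>)

text \<open>Exponents of opposite sign may cancel. At a zero coordinate the law would fail, as
  \<open>0 powi 1 * 0 powi (- 1)\<close> is 0 while \<open>0 powi 0\<close> is 1.\<close>

lemma prod_powi_add:
  fixes t :: "nat \<Rightarrow> complex"
  assumes "\<And>i. t i \<noteq> 0"
  shows "(\<Prod>i \<in> Poly_Mapping.keys (d + e). t i powi Poly_Mapping.lookup (d + e) i) =
    (\<Prod>i \<in> Poly_Mapping.keys d. t i powi Poly_Mapping.lookup d i) *
    (\<Prod>i \<in> Poly_Mapping.keys e. t i powi Poly_Mapping.lookup e i)"
proof -
  let ?S = "Poly_Mapping.keys d \<union> Poly_Mapping.keys e"
  have "Poly_Mapping.keys (d + e) \<subseteq> ?S" by (rule Poly_Mapping.keys_add)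
  then have "(\<Prod>i \<in> Poly_Mapping.keys (d + e). t i powi Poly_Mapping.lookup (d + e) i) =
      (\<Prod>i\<in>?S. t i powi Poly_Mapping.lookup (d + e) i)"
    by (intro prod_powi_superset) auto
  also have "\<dots> = (\<Prod>i\<in>?S. t i powi Poly_Mapping.lookup d i) * (\<Prod>i\<in>?S. t i powi Poly_Mapping.lookup e i)"
    using assms by (simp add: lookup_add power_int_add prod.distrib)
  finally show ?thesis
    using prod_powi_superset[of ?S d t] prod_powi_superset[of ?S e t] by simp
qed

lemma poly_mapping_sum_single:
  "(\<Sum>e\<in>Poly_Mapping.keys q. Poly_Mapping.single e (Poly_Mapping.lookup q e)) = q"
  by (rule poly_mapping_eqI)
    (simp add: lookup_sum lookup_single when_def sum.delta in_keys_iff)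

lemma laurent_eval_mult:
  assumes "\<And>i. t i \<noteq> 0"
  shows "laurent_eval (p * q) t = laurent_eval p t * laurent_eval q t"
proof -
  let ?m = "\<lambda>e. (\<Prod>i \<in> Poly_Mapping.keys e. t i powi Poly_Mapping.lookup e i)"
  have "p * q = (\<Sum>d\<in>Poly_Mapping.keys p. \<Sum>e\<in>Poly_Mapping.keys q.
      Poly_Mapping.single (d + e) (Poly_Mapping.lookup p d * Poly_Mapping.lookup q e))"
    using sum_product[of "\<lambda>d. Poly_Mapping.single d (Poly_Mapping.lookup p d)" "Poly_Mapping.keys p"
        "\<lambda>e. Poly_Mapping.single e (Poly_Mapping.lookup q e)" "Poly_Mapping.keys q"]
    by (simp add: poly_mapping_sum_single mult_single)
  also have "laurent_eval \<dots> t = (\<Sum>d\<in>Poly_Mapping.keys p. \<Sum>e\<in>Poly_Mapping.keys q.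
      (Poly_Mapping.lookup p d * ?m d) * (Poly_Mapping.lookup q e * ?m e))"
    by (simp add: laurent_eval_sum laurent_eval_single prod_powi_add[OF assms] algebra_simps)
  also have "\<dots> = laurent_eval p t * laurent_eval q t"
    by (simp add: laurent_eval_def sum_product)
  finally show ?thesis .
qed

lemma laurent_eval_one: "laurent_eval 1 t = 1"
  unfolding single_one[symmetric] laurent_eval_single by simp

lemma comm_ring_hom_laurent_eval:
  assumes "\<And>i. t i \<noteq> 0"
  shows "comm_ring_hom (\<lambda>q. laurent_eval q t)"
  by unfold_locales
    (simp_all add: laurent_eval_zero laurent_eval_one laurent_eval_add laurent_eval_mult[OF assms])

lemma laurent_eval_var_power: "laurent_eval (laurent_var_power i k) t = t i powi k"
  by (cases "k = 0") (simp_all add: laurent_var_power_def laurent_eval_single laurent_eval_one)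

text \<open>Evaluation is multiplicative only at points without zero coordinates, whereas the
  coordinates from \<open>N\<close> on of the chosen eigenvalue sequence are arbitrary; they may be changed
  for polynomials in the first \<open>N\<close> variables.\<close>

definition laurent_vars_below :: "nat \<Rightarrow> laurent_poly set" where
  "laurent_vars_below N = {q. \<forall>e\<in>Poly_Mapping.keys q. Poly_Mapping.keys e \<subseteq> {..<N}}"

lemma laurent_vars_below_add:
  "p \<in> laurent_vars_below N \<Longrightarrow> q \<in> laurent_vars_below N \<Longrightarrow> p + q \<in> laurent_vars_below N"
  using Poly_Mapping.keys_add[of p q] unfolding laurent_vars_below_def by blast

lemma laurent_vars_below_diff:
  "p \<in> laurent_vars_below N \<Longrightarrow> q \<in> laurent_vars_below N \<Longrightarrow> p - q \<in> laurent_vars_below N"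
  using Poly_Mapping.keys_diff[of p q] unfolding laurent_vars_below_def by blast

lemma laurent_vars_below_mult:
  assumes "p \<in> laurent_vars_below N" "q \<in> laurent_vars_below N"
  shows "p * q \<in> laurent_vars_below N"
  unfolding laurent_vars_below_def
proof (intro CollectI ballI)
  fix e assume "e \<in> Poly_Mapping.keys (p * q)"
  then obtain a b where ab: "e = a + b" "a \<in> Poly_Mapping.keys p" "b \<in> Poly_Mapping.keys q"
    using Poly_Mapping.keys_mult[of p q] by blast
  then show "Poly_Mapping.keys e \<subseteq> {..<N}"
    using Poly_Mapping.keys_add[of a b] assms unfolding laurent_vars_below_def by blast
qed

lemma laurent_vars_below_const: "0 \<in> laurent_vars_below N" "1 \<in> laurent_vars_below N"
  by (auto simp: laurent_vars_below_def)

lemma laurent_vars_below_sum: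
  "(\<And>a. a \<in> A \<Longrightarrow> f a \<in> laurent_vars_below N) \<Longrightarrow> sum f A \<in> laurent_vars_below N"
  by (induction A rule: infinite_finite_induct)
    (auto simp: laurent_vars_below_const intro!: laurent_vars_below_add)

lemma laurent_vars_below_prod:
  "(\<And>a. a \<in> A \<Longrightarrow> f a \<in> laurent_vars_below N) \<Longrightarrow> prod f A \<in> laurent_vars_below N"
  by (induction A rule: infinite_finite_induct)
    (auto simp: laurent_vars_below_const intro!: laurent_vars_below_mult)

lemma laurent_vars_below_det:
  assumes "\<And>i j. i < N' \<Longrightarrow> j < N' \<Longrightarrow> f i j \<in> laurent_vars_below N"
  shows "Determinant.det (Matrix.mat N' N' (\<lambda>(i, j). f i j)) \<in> laurent_vars_below N"
proof -
  \<comment> \<open>The sign -1 is reached as the difference of the constants 0 and 1.\<close>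
  have "signof p \<in> laurent_vars_below N" for p
    using laurent_vars_below_diff[OF laurent_vars_below_const(1) laurent_vars_below_const(2), of N]
    by (cases p rule: sign_cases) (auto simp: laurent_vars_below_const)
  then show ?thesis
    unfolding det_def
    by (auto intro!: laurent_vars_below_sum laurent_vars_below_mult laurent_vars_below_prod assms
        dest: permutes_in_image)
qed

lemma laurent_vars_below_var_power: "i < N \<Longrightarrow> laurent_var_power i k \<in> laurent_vars_below N"
  by (auto simp: laurent_vars_below_def laurent_var_power_def split: if_splits)

lemma laurent_eval_cong:
  assumes "q \<in> laurent_vars_below N" "\<And>i. i < N \<Longrightarrow> t i = s i"
  shows "laurent_eval q t = laurent_eval q s"
  unfolding laurent_eval_def
  by (rule sum.cong[OF refl], rule arg_cong2[where f = "(*)"], rule refl, rule prod.cong)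
    (use assms in \<open>auto simp: laurent_vars_below_def subset_iff\<close>)

section \<open>An infinite Cauchy-Binet formula\<close>

lemma has_sum_times:
  fixes f :: "'a \<Rightarrow> complex" and g :: "'b \<Rightarrow> complex"
  assumes f: "(f has_sum a) A" and g: "(g has_sum b) B"
  shows "((\<lambda>(x, y). f x * g y) has_sum a * b) (A \<times> B)"
proof (rule has_sum_SigmaI)
  show "((\<lambda>y. case (x, y) of (x, y) \<Rightarrow> f x * g y) has_sum f x * b) B" for x
    using has_sum_cmult_right[OF g] by simp
  show "((\<lambda>x. f x * b) has_sum a * b) A"
    by (rule has_sum_cmult_left[OF f])
  \<comment> \<open>Summing iteratively needs joint summability. Complex summability is absolute, so
    the norms of the factors provide it.\<close>
  have f': "(\<lambda>x. cmod (f x)) summable_on A" and g': "(\<lambda>y. cmod (g y)) summable_on B"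
    using has_sum_imp_summable[OF f] has_sum_imp_summable[OF g]
    by (simp_all add: summable_on_iff_abs_summable_on_complex)
  have "(\<lambda>p. cmod (case p of (x, y) \<Rightarrow> f x * g y)) summable_on A \<times> B"
  proof (rule summable_on_SigmaI)
    show "((\<lambda>y. cmod (case (x, y) of (x, y) \<Rightarrow> f x * g y)) has_sum
        cmod (f x) * infsum (\<lambda>y. cmod (g y)) B) B" for x
      using has_sum_cmult_right[OF has_sum_infsum[OF g'], of "cmod (f x)"]
      by (simp add: norm_mult)
  qed (use f' in \<open>auto intro: summable_on_cmult_left\<close>)
  then show "(\<lambda>(x, y). f x * g y) summable_on A \<times> B"
    by (simp add: summable_on_iff_abs_summable_on_complex)
qed

lemma has_sum_prod_PiE:
  fixes f :: "'a \<Rightarrow> 'b \<Rightarrow> complex"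
  assumes "finite A" "\<And>x. x \<in> A \<Longrightarrow> (f x has_sum s x) (B x)"
  shows "((\<lambda>g. \<Prod>x\<in>A. f x (g x)) has_sum (\<Prod>x\<in>A. s x)) (PiE A B)"
  using assms
proof (induction A)
  case empty
  then show ?case by (auto intro: has_sum_finiteI)
next
  case (insert x A)
  have "((\<lambda>(y, g). f x y * (\<Prod>x\<in>A. f x (g x))) has_sum s x * (\<Prod>x\<in>A. s x)) (B x \<times> PiE A B)"
    by (rule has_sum_times) (use insert in auto)
  \<comment> \<open>A function on \<open>insert x A\<close> is split into its value at
    \<open>x\<close> and the rest; resetting the rest to \<open>undefined\<close> at
    \<open>x\<close> keeps it extensional.\<close>
  also have "?this \<longleftrightarrow> ((\<lambda>g. \<Prod>x\<in>insert x A. f x (g x)) has_sum s x * (\<Prod>x\<in>A. s x))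
      (PiE (insert x A) B)"
  proof (rule has_sum_reindex_bij_witness[where j = "\<lambda>(y, g). g(x := y)"
        and i = "\<lambda>g. (g x, g(x := undefined))"])
    fix p assume "p \<in> B x \<times> PiE A B"
    then obtain y g where p: "p = (y, g)" "y \<in> B x" "g \<in> PiE A B" by auto
    then have "g x = undefined" using insert by (auto simp: PiE_def extensional_def)
    then show "((case p of (y, g) \<Rightarrow> g(x := y)) x, (case p of (y, g) \<Rightarrow> g(x := y))(x := undefined)) = p"
      using p by auto
    show "(case p of (y, g) \<Rightarrow> g(x := y)) \<in> PiE (insert x A) B"
      using p by (auto simp: PiE_insert_eq)
    have "(\<Prod>x'\<in>A. f x' ((g(x := y)) x')) = (\<Prod>x'\<in>A. f x' (g x'))"
      by (rule prod.cong) (use insert in auto)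
    then show "(\<Prod>x'\<in>insert x A. f x' ((case p of (y, g) \<Rightarrow> g(x := y)) x')) =
        (case p of (y, g) \<Rightarrow> f x y * (\<Prod>x\<in>A. f x (g x)))"
      using p insert by simp
  next
    fix g assume g: "g \<in> PiE (insert x A) B"
    then show "(g x, g(x := undefined)) \<in> B x \<times> PiE A B"
      using insert by (auto simp: PiE_def extensional_def Pi_def)
  qed auto
  finally show ?case using insert by simp
qed

lemma has_sum_finite_sum:
  fixes f :: "'a \<Rightarrow> 'b \<Rightarrow> complex"
  assumes "\<And>x. x \<in> A \<Longrightarrow> (f x has_sum s x) B"
  shows "((\<lambda>y. \<Sum>x\<in>A. f x y) has_sum (\<Sum>x\<in>A. s x)) B"
  using assms by (induction A rule: infinite_finite_induct) (auto intro: has_sum_add)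

lemma det_mat_Leibniz:
  "Determinant.det (Matrix.mat N N (\<lambda>(i, j). f i j)) =
    (\<Sum>p | p permutes {..<N}. signof p * (\<Prod>i<N. f i (p i)))"
proof -
  have "(\<Prod>i<N. Matrix.mat N N (\<lambda>(i, j). f i j) $$ (i, p i)) = (\<Prod>i<N. f i (p i))"
    if "p permutes {..<N}" for p
    using permutes_in_image[OF that] by (intro prod.cong) auto
  then show ?thesis by (simp add: det_def atLeast0LessThan)
qed

lemma det_mat_swap:
  "Determinant.det (Matrix.mat N N (\<lambda>(i, j). f j i)) = Determinant.det (Matrix.mat N N (\<lambda>(i, j). f i j))"
proof -
  have "Matrix.mat N N (\<lambda>(i, j). f j i) = transpose_mat (Matrix.mat N N (\<lambda>(i, j). f i j))"
    by auto
  then show ?thesis by (simp add: det_transpose[of _ N])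
qed

text \<open>Multilinearity in the rows: each Leibniz term of the right side is a product of
  \<open>N\<close> series, which expands into a sum over all choices \<open>f\<close> of one
  summation index per row.\<close>

lemma has_sum_det_rows:
  fixes w :: "nat \<Rightarrow> nat \<Rightarrow> complex"
  assumes "\<And>i j. i < N \<Longrightarrow> j < N \<Longrightarrow> ((\<lambda>m. a i m * v m j) has_sum w i j) A"
  shows "((\<lambda>f. (\<Prod>i<N. a i (f i)) * Determinant.det (Matrix.mat N N (\<lambda>(i, j). v (f i) j)))
    has_sum Determinant.det (Matrix.mat N N (\<lambda>(i, j). w i j))) (PiE {..<N} (\<lambda>_. A))"
proof -
  have "((\<lambda>f. \<Sum>p | p permutes {..<N}. signof p * (\<Prod>i<N. a i (f i) * v (f i) (p i))) has_sum
    (\<Sum>p | p permutes {..<N}. signof p * (\<Prod>i<N. w i (p i)))) (PiE {..<N} (\<lambda>_. A))"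
  proof (intro has_sum_finite_sum has_sum_cmult_right has_sum_prod_PiE assms)
    fix p i assume "p \<in> {p. p permutes {..<N}}" "i \<in> {..<N}"
    then show "i < N" "p i < N" using permutes_in_image[of p "{..<N}" i] by auto
  qed auto
  then show ?thesis
    by (simp add: det_mat_Leibniz sum_distrib_left prod.distrib algebra_simps)
qed

section \<open>Dominant weights as N-element sets of positive integers\<close>

text \<open>The highest weight plus the half sum N, ..., 1 of the positive roots of type C.\<close>

definition shifted_weight :: "nat \<Rightarrow> nat list \<Rightarrow> nat \<Rightarrow> nat" where
  "shifted_weight N n k = n ! k + (N - k)"

lemma shifted_weight_less:
  assumes "n \<in> dominant_weights N" "k < l" "l < N"
  shows "shifted_weight N n l < shifted_weight N n k"
proof -
  have "n ! l \<le> n ! k"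
    using assms by (auto simp: dominant_weights_def sorted_wrt_iff_nth_less)
  then show ?thesis using assms by (simp add: shifted_weight_def)
qed

lemma shifted_weight_inj:
  assumes "n \<in> dominant_weights N"
  shows "inj_on (shifted_weight N n) {..<N}"
proof (rule inj_onI)
  fix k l assume *: "k \<in> {..<N}" "l \<in> {..<N}" "shifted_weight N n k = shifted_weight N n l"
  then show "k = l"
    using shifted_weight_less[OF assms, of k l] shifted_weight_less[OF assms, of l k]
    by (cases k l rule: linorder_cases) auto
qed

text \<open>A finite set of numbers has only one increasing enumeration, so the shifted tuple can be
  read off its set of values.\<close>

lemma shifted_weight_determines:
  assumes "n \<in> dominant_weights N" "n' \<in> dominant_weights N"
    and "shifted_weight N n ` {..<N} = shifted_weight N n' ` {..<N}"
  shows "n = n'"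
proof -
  define L where "L n = rev (map (shifted_weight N n) [0..<N])" for n
  have L: "sorted (L n)" "distinct (L n)" "set (L n) = shifted_weight N n ` {..<N}"
    if "n \<in> dominant_weights N" for n
  proof -
    have "sorted_wrt (\<ge>) (map (shifted_weight N n) [0..<N])"
      using shifted_weight_less[OF that] by (force simp: sorted_wrt_iff_nth_less)
    then show "sorted (L n)" by (simp add: L_def sorted_wrt_rev)
    show "distinct (L n)" "set (L n) = shifted_weight N n ` {..<N}"
      using shifted_weight_inj[OF that] by (auto simp: L_def distinct_map atLeast0LessThan)
  qed
  have "L n = L n'"
    by (rule sorted_distinct_set_unique) (use L assms in auto)
  then have *: "map (shifted_weight N n) [0..<N] = map (shifted_weight N n') [0..<N]"
    by (simp add: L_def)
  show ?thesis
  proof (rule nth_equalityI)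
    fix k assume "k < length n"
    then have "k < N" using assms by (simp add: dominant_weights_def)
    then have "shifted_weight N n k = shifted_weight N n' k"
      using * by auto
    then show "n ! k = n' ! k" by (simp add: shifted_weight_def)
  qed (use assms in \<open>simp add: dominant_weights_def\<close>)
qed

lemma shifted_weight_surj:
  assumes "finite S" "card S = N" "S \<subseteq> {1..}"
  obtains n where "n \<in> dominant_weights N" "shifted_weight N n ` {..<N} = S"
proof -
  define L where "L = rev (sorted_list_of_set S)"
  have len: "length L = N" using assms by (simp add: L_def)
  have set: "set L = S" using assms by (simp add: L_def)
  have dec: "L ! l < L ! k" if "k < l" "l < N" for k l
  proof -
    have "sorted_wrt (>) L"
      using strict_sorted_list_of_set[of S] by (simp add: L_def sorted_wrt_rev)
    then show ?thesis using that len by (auto simp: sorted_wrt_iff_nth_less)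
  qed
  \<comment> \<open>A strictly decreasing list whose last entry is at least 1 dominates the
    staircase, by induction from the end. Hence the truncated subtraction defining \<open>n\<close>
    below is exact.\<close>
  have low: "N - k \<le> L ! k" if "k < N" for k
    using that
  proof (induction "N - k" arbitrary: k)
    case (Suc d)
    show ?case
    proof (cases "Suc k < N")
      case True
      then have "N - Suc k \<le> L ! Suc k" using Suc by (intro Suc(1)) auto
      then show ?thesis using dec[of k "Suc k"] True by auto
    next
      case False
      have "L ! k \<in> S" using set len Suc(3) by auto
      then have "1 \<le> L ! k" using assms(3) by auto
      then show ?thesis using False by auto
    qed
  qed auto
  define n where "n = map (\<lambda>k. L ! k - (N - k)) [0..<N]"
  have sw: "shifted_weight N n k = L ! k" if "k < N" for k
    using low[OF that] that by (simp add: shifted_weight_def n_def)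
  \<comment> \<open>Each step of \<open>L\<close> falls by at least one, which makes up for the
    staircase falling by exactly one.\<close>
  have mono: "L ! l - (N - l) \<le> L ! k - (N - k)" if "k < l" "l < N" for k l
    using that
  proof (induction l)
    case (Suc l)
    then have "L ! Suc l - (N - Suc l) \<le> L ! l - (N - l)"
      using dec[of l "Suc l"] by auto
    then show ?case using Suc by (cases "k = l") auto
  qed simp
  have "n \<in> dominant_weights N"
    using mono by (auto simp: dominant_weights_def n_def sorted_wrt_iff_nth_less)
  moreover have "shifted_weight N n ` {..<N} = S"
    unfolding set[symmetric] set_conv_nth len using sw by force
  ultimately show ?thesis using that by blast
qed

text \<open>An injective choice of positive indices amounts to its set of values, hence a dominant
  weight, together with the order in which these values are taken.\<close>

lemma bij_betw_dominant_weights_permutations: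
  "bij_betw (\<lambda>(n, p). restrict (shifted_weight N n \<circ> p) {..<N})
    (dominant_weights N \<times> {p. p permutes {..<N}})
    {f \<in> PiE {..<N} (\<lambda>_. {1..}). inj_on f {..<N}}"
proof (rule bij_betw_imageI)
  let ?g = "\<lambda>(n, p). restrict (shifted_weight N n \<circ> p) {..<N}"
  have im: "?g (n, p) ` {..<N} = shifted_weight N n ` {..<N}" if "p permutes {..<N}" for n p
  proof -
    have "?g (n, p) ` {..<N} = shifted_weight N n ` (p ` {..<N})" by force
    then show ?thesis by (simp add: permutes_image[OF that])
  qed
  show "inj_on ?g (dominant_weights N \<times> {p. p permutes {..<N}})"
  proof (rule inj_onI)
    fix x x' assume *: "x \<in> dominant_weights N \<times> {p. p permutes {..<N}}"
      "x' \<in> dominant_weights N \<times> {p. p permutes {..<N}}" "?g x = ?g x'"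
    then obtain n p n' p' where x: "x = (n, p)" "x' = (n', p')" by fastforce
    have np: "n \<in> dominant_weights N" "n' \<in> dominant_weights N"
      "p permutes {..<N}" "p' permutes {..<N}" using * x by auto
    have n: "n = n'"
      by (rule shifted_weight_determines[OF np(1,2)]) (metis im np(3,4) *(3) x)
    have "p j = p' j" if "j < N" for j
    proof -
      have "shifted_weight N n (p j) = shifted_weight N n (p' j)"
        using fun_cong[OF *(3), of j] that x n by simp
      then show ?thesis
        using shifted_weight_inj[OF np(1)] permutes_in_image[OF np(3)] permutes_in_image[OF np(4)] that
        by (auto dest: inj_onD)
    qed
    moreover have "p j = p' j" if "\<not> j < N" for j
      using np(3,4) that by (simp add: permutes_def)
    ultimately show "x = x'" using x n by auto
  qed
  show "?g ` (dominant_weights N \<times> {p. p permutes {..<N}}) =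
      {f \<in> PiE {..<N} (\<lambda>_. {1..}). inj_on f {..<N}}" (is "?L = ?R")
  proof (intro equalityI subsetI)
    fix f assume "f \<in> ?L"
    then obtain n p where f: "f = ?g (n, p)" and np: "n \<in> dominant_weights N" "p permutes {..<N}"
      by blast
    have "inj_on (shifted_weight N n \<circ> p) {..<N}"
      using shifted_weight_inj[OF np(1)] permutes_image[OF np(2)] permutes_inj_on[OF np(2)]
      by (auto intro: comp_inj_on)
    moreover have "1 \<le> shifted_weight N n (p j)" if "j < N" for j
      using permutes_in_image[OF np(2), of j] that by (simp add: shifted_weight_def)
    ultimately show "f \<in> ?R" by (auto simp: f)
  next
    fix f assume f: "f \<in> ?R"
    then have "card (f ` {..<N}) = N" by (simp add: card_image)
    then obtain n where n: "n \<in> dominant_weights N" "shifted_weight N n ` {..<N} = f ` {..<N}"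
      using f by (elim shifted_weight_surj[rotated]) auto
    let ?s = "shifted_weight N n"
    have bs: "bij_betw ?s {..<N} (f ` {..<N})"
      using shifted_weight_inj[OF n(1)] n(2) by (simp add: bij_betw_def)
    \<comment> \<open>\<open>p j\<close> is the position of the value \<open>f j\<close> in the
      decreasing enumeration; it is the identity outside \<open>{..<N}\<close>, as
      \<open>permutes\<close> demands.\<close>
    define p where "p j = (if j < N then inv_into {..<N} ?s (f j) else j)" for j
    have "bij_betw (inv_into {..<N} ?s \<circ> f) {..<N} {..<N}"
      by (rule bij_betw_trans[OF _ bij_betw_inv_into[OF bs]]) (use f in \<open>auto simp: bij_betw_def\<close>)
    then have "bij_betw p {..<N} {..<N}"
      by (rule iffD1[OF bij_betw_cong, rotated]) (simp add: p_def)
    then have p: "p permutes {..<N}"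
      by (rule bij_imp_permutes) (simp add: p_def)
    have "?s (p j) = f j" if "j < N" for j
      using that n(2) by (simp add: p_def f_inv_into_f)
    then have "f = ?g (n, p)"
      using f by (auto simp: fun_eq_iff PiE_def extensional_def)
    then show "f \<in> ?L" using n(1) p by blast
  qed
qed

text \<open>In the expansion of \<open>has_sum_det_rows\<close>, a repeated index gives two equal
  rows and drops out. The injective choices are grouped by dominant weight; the sum over the
  orderings of one weight is the Leibniz formula for the determinant of the coefficients
  \<open>a\<close>.\<close>

lemma has_sum_Cauchy_Binet:
  fixes w :: "nat \<Rightarrow> nat \<Rightarrow> complex"
  assumes "\<And>i j. i < N \<Longrightarrow> j < N \<Longrightarrow> ((\<lambda>m. a i m * v m j) has_sum w i j) {1..}"
  shows "((\<lambda>n. Determinant.det (Matrix.mat N N (\<lambda>(i, k). a i (shifted_weight N n k)))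
      * Determinant.det (Matrix.mat N N (\<lambda>(k, j). v (shifted_weight N n k) j)))
    has_sum Determinant.det (Matrix.mat N N (\<lambda>(i, j). w i j))) (dominant_weights N)"
proof -
  define D where "D f = Determinant.det (Matrix.mat N N (\<lambda>(i, j). v (f i) j))" for f
  define F where "F f = (\<Prod>i<N. a i (f i)) * D f" for f
  define S where "S = Determinant.det (Matrix.mat N N (\<lambda>(i, j). w i j))"
  let ?g = "\<lambda>(n, p). restrict (shifted_weight N n \<circ> p) {..<N}"
  have D0: "D f = 0" if ninj: "\<not> inj_on f {..<N}" for f
  proof -
    obtain k l where "k < N" "l < N" "k \<noteq> l" "f k = f l"
      using ninj unfolding inj_on_def lessThan_iff by blast
    then show ?thesis unfolding D_def
      by (intro det_identical_rows[of _ N k l]) (auto simp: row_def)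
  qed
  have "(F has_sum S) (PiE {..<N} (\<lambda>_. {1..}))"
    using has_sum_det_rows[OF assms] by (simp add: F_def[abs_def] D_def S_def)
  then have "(F has_sum S) {f \<in> PiE {..<N} (\<lambda>_. {1..}). inj_on f {..<N}}"
    by (rule iffD1[OF has_sum_cong_neutral, rotated -1]) (auto simp: F_def D0)
  then have "((\<lambda>x. F (?g x)) has_sum S) (dominant_weights N \<times> {p. p permutes {..<N}})"
    by (subst has_sum_reindex_bij_betw[OF bij_betw_dominant_weights_permutations])
  then have sum: "((\<lambda>n. \<Sum>p | p permutes {..<N}. F (?g (n, p))) has_sum S) (dominant_weights N)"
    by (rule has_sum_SigmaD) (auto intro!: has_sum_finite finite_permutations)
  have "(\<Sum>p | p permutes {..<N}. F (?g (n, p))) =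
      Determinant.det (Matrix.mat N N (\<lambda>(i, k). a i (shifted_weight N n k))) * D (shifted_weight N n)"
    for n
  proof -
    have "F (?g (n, p)) = signof p * (\<Prod>i<N. a i (shifted_weight N n (p i))) * D (shifted_weight N n)"
      if p: "p permutes {..<N}" for p
    proof -
      let ?A = "Matrix.mat N N (\<lambda>(i, j). v (shifted_weight N n i) j)"
      have "D (?g (n, p)) = Determinant.det (Matrix.mat N N (\<lambda>(i, j). ?A $$ (p i, j)))"
        unfolding D_def using permutes_in_image[OF p]
        by (intro arg_cong[where f = Determinant.det] eq_matI) auto
      also have "\<dots> = signof p * Determinant.det ?A"
        by (rule det_permute_rows) (use p in \<open>auto simp: atLeast0LessThan\<close>)
      finally show ?thesis by (simp add: F_def D_def)
    qed
    then show ?thesis by (simp add: det_mat_Leibniz sum_distrib_right)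
  qed
  with sum show ?thesis by (simp add: D_def S_def)
qed

section \<open>The exponential of the bidiagonal matrix\<close>

text \<open>The odd extension makes the recurrence hold at 0 and below as well, so iterating it
  meets no boundary.\<close>

definition cheb_diff_int :: "nat \<Rightarrow> (nat \<Rightarrow> 'a :: comm_ring_1) \<Rightarrow> int \<Rightarrow> nat \<Rightarrow> 'a" where
  "cheb_diff_int N y k i = (if 0 \<le> k then cheb_diff N y (nat k) i else - cheb_diff N y (nat (- k)) i)"

lemma cheb_diff_int_minus: "cheb_diff_int N y (- k) i = - cheb_diff_int N y k i"
  by (cases k "0 :: int" rule: linorder_cases) (simp_all add: cheb_diff_int_def)

lemma cheb_diff_int_rec:
  "newton_op y (cheb_diff_int N y k) i = cheb_diff_int N y (k + 1) i + cheb_diff_int N y (k - 1) i"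
proof -
  have pos: "newton_op y (cheb_diff_int N y (int (Suc m))) i =
      cheb_diff_int N y (int (Suc m) + 1) i + cheb_diff_int N y (int (Suc m) - 1) i" for m
  proof -
    have "nat (2 + int m) = Suc (Suc m)" "nat (1 + int m) = Suc m" by auto
    then show ?thesis by (simp add: cheb_diff_int_def newton_op_def)
  qed
  consider "k = 0" | m where "k = int (Suc m)" | m where "k = - int (Suc m)"
    by (metis int_cases3 gr0_conv_Suc)
  then show ?thesis
  proof cases
    case 1
    then show ?thesis by (simp add: newton_op_def cheb_diff_int_def)
  next
    case (2 m)
    then show ?thesis using pos by simp
  next
    case (3 m)
    have "newton_op y (cheb_diff_int N y k) i = - newton_op y (cheb_diff_int N y (- k)) i"
      using cheb_diff_int_minus[of N y k] by (simp add: newton_op_def)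
    also have "\<dots> = - (cheb_diff_int N y (- k + 1) i + cheb_diff_int N y (- k - 1) i)"
      using pos[of m] 3 by (simp add: add_ac)
    also have "\<dots> = cheb_diff_int N y (k + 1) i + cheb_diff_int N y (k - 1) i"
    proof -
      have "- k + 1 = - (k - 1)" "- k - 1 = - (k + 1)" by simp_all
      then show ?thesis by (simp only: cheb_diff_int_minus) simp
    qed
    finally show ?thesis .
  qed
qed

lemma sum_binomial_Suc:
  fixes g :: "nat \<Rightarrow> 'a :: comm_semiring_1"
  shows "(\<Sum>l\<le>Suc n. of_nat (Suc n choose l) * g l) = (\<Sum>l\<le>n. of_nat (n choose l) * (g l + g (Suc l)))"
proof -
  have "(\<Sum>l\<le>Suc n. of_nat (Suc n choose l) * g l) =
      g 0 + (\<Sum>l\<le>n. of_nat (n choose Suc l) * g (Suc l)) + (\<Sum>l\<le>n. of_nat (n choose l) * g (Suc l))"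
    by (subst sum.atMost_Suc_shift) (simp add: sum.distrib algebra_simps)
  also have "g 0 + (\<Sum>l\<le>n. of_nat (n choose Suc l) * g (Suc l)) = (\<Sum>l\<le>Suc n. of_nat (n choose l) * g l)"
    by (subst sum.atMost_Suc_shift) simp
  also have "\<dots> = (\<Sum>l\<le>n. of_nat (n choose l) * g l)" by (simp add: binomial_eq_0)
  finally show ?thesis by (simp add: sum.distrib algebra_simps)
qed

text \<open>On these vectors J is the sum of the two opposite unit shifts of the index, which
  commute; \<open>l\<close> counts the downward shifts.\<close>

lemma newton_op_power_cheb_diff:
  "(newton_op y ^^ n) (cheb_diff_int N y k) i =
     (\<Sum>l\<le>n. of_nat (n choose l) * cheb_diff_int N y (k + int n - 2 * int l) i)"
proof (induction n arbitrary: i)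
  case (Suc n)
  have "(newton_op y ^^ Suc n) (cheb_diff_int N y k) i =
    (\<Sum>l\<le>n. of_nat (n choose l) * newton_op y (cheb_diff_int N y (k + int n - 2 * int l)) i)"
    by (simp add: newton_op_def Suc sum_distrib_left sum.distrib algebra_simps)
  also have "\<dots> = (\<Sum>l\<le>n. of_nat (n choose l) *
      (cheb_diff_int N y (k + int (Suc n) - 2 * int l) i
       + cheb_diff_int N y (k + int (Suc n) - 2 * int (Suc l)) i))"
    unfolding cheb_diff_int_rec by (simp add: algebra_simps)
  also have "\<dots> = (\<Sum>l\<le>Suc n. of_nat (Suc n choose l) *
      cheb_diff_int N y (k + int (Suc n) - 2 * int l) i)"
    by (rule sum_binomial_Suc[symmetric])
  finally show ?case .
qed simp

text \<open>The entry of \<open>J^n\<close> in row \<open>i\<close> and column \<open>k\<close>,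
  obtained by applying the power to a unit vector.\<close>

definition newton_entry :: "(nat \<Rightarrow> 'a :: comm_ring_1) \<Rightarrow> nat \<Rightarrow> nat \<Rightarrow> nat \<Rightarrow> 'a" where
  "newton_entry y n i k = (newton_op y ^^ n) (\<lambda>i. if i = k then 1 else 0) i"

lemma newton_entry_rec:
  "newton_entry y 0 i k = (if i = k then 1 else 0)"
  "newton_entry y (Suc n) i k = y i * newton_entry y n i k + newton_entry y n (Suc i) k"
  by (simp_all add: newton_entry_def newton_op_def)

lemma newton_op_power_expand:
  assumes "\<And>k. N \<le> k \<Longrightarrow> w k = 0"
  shows "(newton_op y ^^ n) w i = (\<Sum>k<N. newton_entry y n i k * w k)"
proof (induction n arbitrary: i)
  case 0
  have "(\<Sum>k<N. newton_entry y 0 i k * w k) = (\<Sum>k<N. if k = i then w k else 0)"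
    by (rule sum.cong) (auto simp: newton_entry_rec)
  then show ?case using assms[of i] by auto
next
  case (Suc n)
  then show ?case
    by (simp add: newton_op_def newton_entry_rec sum_distrib_left sum.distrib algebra_simps)
qed

lemma newton_entry_below: "k < i \<Longrightarrow> newton_entry y n i k = 0"
  by (induction n arbitrary: i) (auto simp: newton_entry_rec)

lemma newton_entry_diag: "newton_entry y n i i = y i ^ n"
  by (induction n) (auto simp: newton_entry_rec newton_entry_below)

section \<open>Growth bounds and the matrix exponential\<close>

text \<open>The bound 2 is the one for t + 1/t on the unit circle; absolute row sums of J are then
  at most 2 + 1.\<close>

lemma cmod_newton_entry_le:
  assumes "\<And>i. cmod (y i) \<le> 2"
  shows "cmod (newton_entry y n i k) \<le> 3 ^ n"
proof (induction n arbitrary: i)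
  case (Suc n)
  have "cmod (newton_entry y (Suc n) i k) \<le>
      cmod (y i) * cmod (newton_entry y n i k) + cmod (newton_entry y n (Suc i) k)"
    unfolding newton_entry_rec norm_mult[symmetric] by (rule norm_triangle_ineq)
  also have "\<dots> \<le> 2 * 3 ^ n + 3 ^ n"
    by (intro add_mono mult_mono Suc assms) auto
  finally show ?case by simp
qed (simp add: newton_entry_rec)

text \<open>Base 4 works since 3 * 4 + 1 \<le> 4 ^ 2. Any exponential bound is enough against the
  factorials in the later series.\<close>

lemma cmod_cheb_diff_le:
  assumes "\<And>i. cmod (y i) \<le> 2"
  shows "cmod (cheb_diff N y m i) \<le> 4 ^ m"
  using assms
proof (induction N y m arbitrary: i rule: cheb_diff.induct)
  case (3 N y m)
  let ?v = "cheb_diff N y"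
  have "cmod (?v (Suc (Suc m)) i) \<le> cmod (y i * ?v (Suc m) i) + cmod (?v (Suc m) (Suc i)) + cmod (?v m i)"
    using norm_triangle_ineq4[of "y i * ?v (Suc m) i + ?v (Suc m) (Suc i)" "?v m i"]
      norm_triangle_ineq[of "y i * ?v (Suc m) i" "?v (Suc m) (Suc i)"]
    by (simp add: newton_op_def)
  also have "\<dots> \<le> 2 * 4 ^ Suc m + 4 ^ Suc m + 4 ^ m"
    unfolding norm_mult by (intro add_mono mult_mono 3) auto
  also have "\<dots> \<le> 4 ^ Suc (Suc m)" by simp
  finally show ?case .
qed auto

lemma cmod_cheb_diff_int_le:
  "(\<And>i. cmod (y i) \<le> 2) \<Longrightarrow> cmod (cheb_diff_int N y k i) \<le> 4 ^ nat \<bar>k\<bar>"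
  using cmod_cheb_diff_le[of y N "nat \<bar>k\<bar>" i] by (auto simp: cheb_diff_int_def)

lemma summable_on_exp_series: "(\<lambda>n. c ^ n / fact n :: real) summable_on UNIV" if "0 \<le> c"
proof -
  have "summable (\<lambda>n. norm (c ^ n / fact n))"
    using summable_norm_exp[of c] by (simp add: divide_inverse mult.commute)
  then show ?thesis by (rule norm_summable_imp_summable_on)
qed

lemma has_sum_exp: "((\<lambda>n. z ^ n / fact n) has_sum exp z) UNIV" for z :: complex
proof -
  have "summable (\<lambda>n. norm (z ^ n / fact n))"
    using summable_norm_exp[of z] by (simp add: scaleR_conv_of_real divide_inverse mult.commute norm_mult norm_inverse)
  moreover have "(\<lambda>n. z ^ n / fact n) sums exp z"
    using exp_converges[of z] by (simp add: scaleR_conv_of_real divide_inverse mult.commute)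
  ultimately show ?thesis by (rule norm_summable_imp_has_sum)
qed

text \<open>An entry of the matrix \<open>exp(xJ)\<close>.\<close>

definition newton_exp :: "complex \<Rightarrow> (nat \<Rightarrow> complex) \<Rightarrow> nat \<Rightarrow> nat \<Rightarrow> complex" where
  "newton_exp x y i k = infsum (\<lambda>n. x ^ n / fact n * newton_entry y n i k) UNIV"

lemma has_sum_newton_exp:
  assumes "\<And>i. cmod (y i) \<le> 2"
  shows "((\<lambda>n. x ^ n / fact n * newton_entry y n i k) has_sum newton_exp x y i k) UNIV"
proof -
  have "(\<lambda>n. cmod (x ^ n / fact n * newton_entry y n i k)) summable_on UNIV"
  proof (rule abs_summable_on_comparison_test')
    show "(\<lambda>n. (cmod x * 3) ^ n / fact n) summable_on UNIV"
      by (rule summable_on_exp_series) simp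
    show "cmod (x ^ n / fact n * newton_entry y n i k) \<le> (cmod x * 3) ^ n / fact n" for n
      using mult_left_mono[OF cmod_newton_entry_le[of y n i k, OF assms], of "cmod x ^ n / fact n"]
      by (simp add: norm_mult norm_divide norm_power power_mult_distrib)
  qed
  then show ?thesis
    unfolding newton_exp_def by (simp add: summable_on_iff_abs_summable_on_complex)
qed

text \<open>All powers of J are upper triangular with diagonal entries \<open>y i ^ n\<close>, so
  only the scalar exponentials \<open>exp (x * y i)\<close> enter.\<close>

lemma det_newton_exp:
  assumes "\<And>i. cmod (y i) \<le> 2"
  shows "Determinant.det (Matrix.mat N N (\<lambda>(i, k). newton_exp x y i k)) = exp (x * (\<Sum>i<N. y i))"
proof -
  let ?E = "Matrix.mat N N (\<lambda>(i, k). newton_exp x y i k)"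
  have below: "newton_exp x y i k = 0" if "k < i" for i k
    using that by (simp add: newton_exp_def newton_entry_below)
  have diag: "newton_exp x y i i = exp (x * y i)" for i
    using has_sum_exp[of "x * y i"] unfolding newton_exp_def
    by (intro infsumI) (simp add: newton_entry_diag power_mult_distrib)
  have "Determinant.det ?E = prod_list (diag_mat ?E)"
    by (rule det_upper_triangular[where n = N]) (auto simp: below upper_triangular_def)
  also have "\<dots> = (\<Prod>i<N. exp (x * y i))"
    by (simp add: diag_mat_def prod.list_conv_set_nth atLeast0LessThan diag)
  finally show ?thesis by (simp add: exp_sum sum_distrib_left)
qed

section \<open>The action of the exponential in terms of Bessel functions\<close>

text \<open>Bounding \<open>1 / fact (p + nat \<bar>d\<bar>)\<close> by 1 leaves an exponential
  series in \<open>norm x ^ 2\<close>, so the ordered Bessel series is also an unordered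
  sum.\<close>

lemma has_sum_bessel_I:
  "((\<lambda>p. x ^ (2 * p + nat \<bar>d\<bar>) / (fact p * fact (p + nat \<bar>d\<bar>))) has_sum bessel_I d (2 * x)) UNIV"
proof -
  let ?f = "\<lambda>p. x ^ (2 * p + nat \<bar>d\<bar>) / (fact p * fact (p + nat \<bar>d\<bar>))"
  have s: "summable (\<lambda>p. norm (?f p))"
  proof (rule summable_comparison_test'[where N = 0])
    show "summable (\<lambda>p. norm x ^ nat \<bar>d\<bar> * ((norm x ^ 2) ^ p / fact p))"
      using summable_norm_exp[of "norm x ^ 2"]
      by (intro summable_mult) (simp add: divide_inverse mult.commute)
    show "norm (norm (?f p)) \<le> norm x ^ nat \<bar>d\<bar> * ((norm x ^ 2) ^ p / fact p)" for p
    proof -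
      have "norm (?f p) = norm x ^ nat \<bar>d\<bar> * ((norm x ^ 2) ^ p / fact p) / fact (p + nat \<bar>d\<bar>)"
        by (simp add: norm_divide norm_mult norm_power power_add power_mult)
      also have "\<dots> \<le> norm x ^ nat \<bar>d\<bar> * ((norm x ^ 2) ^ p / fact p) / 1"
        by (intro divide_left_mono) (auto simp: fact_ge_1)
      finally show ?thesis by simp
    qed
  qed
  have "?f sums bessel_I d (2 * x)"
    using summable_sums[OF summable_norm_cancel[OF s]] by (simp add: bessel_I_def)
  then show ?thesis using s by (rule norm_summable_imp_has_sum[rotated])
qed

lemma bessel_I_minus: "bessel_I (- k) x = bessel_I k x"
  by (simp add: bessel_I_def)

text \<open>Sum \<open>x^(a+b)/(a! b!) v(\<nu>+a-b)\<close> over all \<open>a, b\<close>, once along the lines \<open>a + b = n\<close> (the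
  exponential series) and once along the lines \<open>a - b = d\<close> (the Bessel series).\<close>

lemma has_sum_newton_exp_cheb_diff_int:
  assumes y: "\<And>i. cmod (y i) \<le> 2"
  shows "((\<lambda>d. bessel_I d (2 * x) * cheb_diff_int N y (v + d) i) has_sum
    (\<Sum>k<N. newton_exp x y i k * cheb_diff_int N y v k)) UNIV"
proof -
  let ?Z = "cheb_diff_int N y"
  define G where "G = (\<lambda>(a, b). x ^ a / fact a * (x ^ b / fact b) * ?Z (v + int a - int b) i)"
  \<comment> \<open>The growth \<open>4 ^ (a + b)\<close> of the vectors is absorbed by passing from
    \<open>cmod x\<close> to \<open>4 * cmod x\<close>.\<close>
  define c where "c = cmod x * 4"
  have "(\<lambda>p. cmod (G p)) summable_on UNIV \<times> UNIV"
  proof (rule abs_summable_on_comparison_test')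
    \<comment> \<open>\<open>has_sum_times\<close> concerns complex families, so the real majorant
      is embedded and recovered as a real part.\<close>
    have c: "(\<lambda>n. complex_of_real (c ^ n / fact n)) summable_on UNIV"
      by (rule summable_on_of_real) (rule summable_on_exp_series, simp add: c_def)
    have "(\<lambda>(a, b). complex_of_real (c ^ a / fact a) * complex_of_real (c ^ b / fact b)) summable_on UNIV \<times> UNIV"
      by (rule has_sum_imp_summable[OF has_sum_times[OF has_sum_infsum[OF c] has_sum_infsum[OF c]]])
    then have "(\<lambda>p. complex_of_real (c ^ fst p / fact (fst p) * (c ^ snd p / fact (snd p)))) summable_on UNIV \<times> UNIV"
      by (simp add: case_prod_unfold)
    then have "(\<lambda>p. c ^ fst p / fact (fst p) * (c ^ snd p / fact (snd p))) summable_on UNIV \<times> UNIV"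
      by (drule_tac summable_on_Re) (simp only: Re_complex_of_real)
    then show "(\<lambda>p. 4 ^ nat \<bar>v\<bar> * (c ^ fst p / fact (fst p) * (c ^ snd p / fact (snd p)))) summable_on UNIV \<times> UNIV"
      by (rule summable_on_cmult_right)
    fix p :: "nat \<times> nat"
    obtain a b where p: "p = (a, b)" by fastforce
    have "cmod (?Z (v + int a - int b) i) \<le> 4 ^ nat \<bar>v + int a - int b\<bar>"
      by (rule cmod_cheb_diff_int_le[of y, OF y])
    also have "\<dots> \<le> 4 ^ (nat \<bar>v\<bar> + a + b)"
      by (rule power_increasing) auto
    finally have "cmod (?Z (v + int a - int b) i) \<le> 4 ^ nat \<bar>v\<bar> * 4 ^ a * 4 ^ b"
      by (simp add: power_add)
    from mult_left_mono[OF this, of "cmod x ^ a / fact a * (cmod x ^ b / fact b)"]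
    show "cmod (G p) \<le> 4 ^ nat \<bar>v\<bar> * (c ^ fst p / fact (fst p) * (c ^ snd p / fact (snd p)))"
      by (simp add: G_def p c_def norm_mult norm_divide norm_power power_mult_distrib algebra_simps)
  qed
  then have "G summable_on UNIV"
    by (simp add: summable_on_iff_abs_summable_on_complex)
  then obtain S where S: "(G has_sum S) UNIV" by (auto simp: summable_on_def)

  \<comment> \<open>Put n = a + b and l = b. Then 1/(a! b!) becomes a binomial coefficient over n!,
    and the inner sum is a power of J applied to the vector.\<close>
  have "((\<lambda>(n, l). x ^ n / fact n * (of_nat (n choose l) * ?Z (v + int n - 2 * int l) i)) has_sum S)
      (SIGMA n:UNIV. {..n})"
  proof (rule iffD1[OF has_sum_reindex_bij_witness[where j = "\<lambda>(a, b). (a + b, b)"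
          and i = "\<lambda>(n, l). (n - l, l)"] S])
    fix q :: "nat \<times> nat" assume "q \<in> (SIGMA n:UNIV. {..n})"
    then obtain n l where q: "q = (n, l)" "l \<le> n" by auto
    then show "(\<lambda>(a, b). (a + b, b)) ((\<lambda>(n, l). (n - l, l)) q) = q" by simp
  next
    fix p :: "nat \<times> nat"
    obtain a b where p: "p = (a, b)" by fastforce
    have "of_nat (a + b choose b) / (fact (a + b) :: complex) = 1 / (fact a * fact b)"
      using binomial_fact[of b "a + b", where 'a = complex] by (simp add: field_simps)
    then have "x ^ (a + b) / fact (a + b) * of_nat (a + b choose b) = x ^ a / fact a * (x ^ b / fact b)"
      by (simp add: power_add field_simps)
    moreover have "v + int (a + b) - 2 * int b = v + int a - int b" by simp
    ultimately show "(case (\<lambda>(a, b). (a + b, b)) p of (n, l) \<Rightarrow>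
        x ^ n / fact n * (of_nat (n choose l) * ?Z (v + int n - 2 * int l) i)) = G p"
      by (simp only: G_def p case_prod_conv mult.assoc[symmetric])
  qed auto
  then have "((\<lambda>n. \<Sum>l\<le>n. x ^ n / fact n * (of_nat (n choose l) * ?Z (v + int n - 2 * int l) i)) has_sum S) UNIV"
    by (rule has_sum_Sigma') (auto intro!: has_sum_finite)
  then have "((\<lambda>n. x ^ n / fact n * (newton_op y ^^ n) (?Z v) i) has_sum S) UNIV"
    by (simp only: newton_op_power_cheb_diff sum_distrib_left)
  moreover have "((\<lambda>n. x ^ n / fact n * (newton_op y ^^ n) (?Z v) i) has_sum
      (\<Sum>k<N. newton_exp x y i k * ?Z v k)) UNIV"
  proof -
    have "((\<lambda>n. \<Sum>k<N. x ^ n / fact n * newton_entry y n i k * ?Z v k) has_sum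
        (\<Sum>k<N. newton_exp x y i k * ?Z v k)) UNIV"
      by (intro has_sum_finite_sum has_sum_cmult_left has_sum_newton_exp y)
    moreover have "?Z v k = 0" if "N \<le> k" for k
      using that by (simp add: cheb_diff_int_def cheb_diff_outside)
    ultimately show ?thesis
      by (simp add: newton_op_power_expand[of N "?Z v"] sum_distrib_left mult.assoc)
  qed
  ultimately have S_eq: "S = (\<Sum>k<N. newton_exp x y i k * ?Z v k)"
    by (rule has_sum_unique)

  \<comment> \<open>Put d = a - b and p = min a b. The larger of a and b is then p + \<bar>d\<bar>,
    and a + b = 2p + \<bar>d\<bar>, which yields the Bessel terms.\<close>
  have "((\<lambda>(d, p). x ^ (2 * p + nat \<bar>d\<bar>) / (fact p * fact (p + nat \<bar>d\<bar>)) * ?Z (v + d) i) has_sum S)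
      (UNIV \<times> UNIV)"
  proof (rule iffD1[OF has_sum_reindex_bij_witness[where j = "\<lambda>(a, b). (int a - int b, min a b)"
          and i = "\<lambda>(d, p). (p + nat d, p + nat (- d))"] S])
    fix q :: "int \<times> nat"
    obtain d p where q: "q = (d, p)" by fastforce
    then show "(\<lambda>(a, b). (int a - int b, min a b)) ((\<lambda>(d, p). (p + nat d, p + nat (- d))) q) = q"
      by auto
  next
    fix p :: "nat \<times> nat"
    obtain a b where p: "p = (a, b)" by fastforce
    then show "(\<lambda>(d, p). (p + nat d, p + nat (- d))) ((\<lambda>(a, b). (int a - int b, min a b)) p) = p"
      by auto
    have "2 * min a b + nat \<bar>int a - int b\<bar> = a + b" by auto
    then have "x ^ (2 * min a b + nat \<bar>int a - int b\<bar>) = x ^ a * x ^ b"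
      by (simp only: power_add)
    moreover have "fact (min a b) * fact (min a b + nat \<bar>int a - int b\<bar>) = (fact a * fact b :: complex)"
      by (cases "a \<le> b") (auto simp: min_def nat_diff_distrib)
    ultimately show "(case (\<lambda>(a, b). (int a - int b, min a b)) p of (d, p) \<Rightarrow>
        x ^ (2 * p + nat \<bar>d\<bar>) / (fact p * fact (p + nat \<bar>d\<bar>)) * ?Z (v + d) i) = G p"
      by (simp add: G_def p add_diff_eq)
  qed auto
  then have "((\<lambda>d. bessel_I d (2 * x) * ?Z (v + d) i) has_sum S) UNIV"
    by (rule has_sum_Sigma') (simp only: case_prod_conv, rule has_sum_cmult_left[OF has_sum_bessel_I])
  then show ?thesis by (simp add: S_eq)
qed

text \<open>Reindex by m = v + d and fold the integers at 0: the vector is odd in its index, so the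
  term at 0 vanishes, and the evenness of \<open>bessel_I\<close> in its order gives the difference
  for m and -m.\<close>

lemma has_sum_newton_exp_cheb_diff:
  assumes y: "\<And>i. cmod (y i) \<le> 2"
  shows "((\<lambda>m. (bessel_I (int m - int v) (2 * x) - bessel_I (int m + int v) (2 * x)) * cheb_diff N y m i)
    has_sum (\<Sum>k<N. newton_exp x y i k * cheb_diff N y v k)) {1..}"
proof -
  let ?Z = "cheb_diff_int N y"
  define S where "S = (\<Sum>k<N. newton_exp x y i k * cheb_diff N y v k)"
  define h where "h m = bessel_I (m - int v) (2 * x) * ?Z m i" for m
  have "((\<lambda>d. bessel_I d (2 * x) * ?Z (int v + d) i) has_sum S) UNIV"
    using has_sum_newton_exp_cheb_diff_int[of y x N "int v" i, OF y] by (simp add: S_def cheb_diff_int_def)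
  also have "?this \<longleftrightarrow> (h has_sum S) UNIV"
    by (rule has_sum_reindex_bij_witness[where i = "\<lambda>m. m - int v" and j = "\<lambda>d. int v + d"])
      (auto simp: h_def)
  finally have h: "(h has_sum S) UNIV" .
  have pos: "(h has_sum infsum h {1..}) {1..}" and neg: "(h has_sum infsum h {..-1}) {..-1}"
    using summable_on_subset_banach[OF has_sum_imp_summable[OF h]] by auto
  have "(h has_sum infsum h {1..} + infsum h {..-1}) ({1..} \<union> {..-1})"
    by (rule has_sum_Un_disjoint[OF pos neg]) auto
  also have "?this \<longleftrightarrow> (h has_sum infsum h {1..} + infsum h {..-1}) UNIV"
  proof (rule has_sum_cong_neutral)
    fix m :: int assume "m \<in> UNIV - ({1..} \<union> {..-1})"
    then have "m = 0" by auto
    then show "h m = 0" by (simp add: h_def cheb_diff_int_def)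
  qed auto
  finally have S: "S = infsum h {1..} + infsum h {..-1}"
    using has_sum_unique[OF h] by blast
  have "((\<lambda>m. h (int m)) has_sum infsum h {1..}) {1..}"
    by (rule iffD1[OF has_sum_reindex_bij_witness[where i = int and j = nat] pos]) auto
  moreover have "((\<lambda>m. h (- int m)) has_sum infsum h {..-1}) {1..}"
    by (rule iffD1[OF has_sum_reindex_bij_witness[where i = "\<lambda>m. - int m" and j = "\<lambda>m. nat (- m)"] neg]) auto
  ultimately have "((\<lambda>m. h (int m) + h (- int m)) has_sum S) {1..}"
    unfolding S by (rule has_sum_add)
  moreover have "h (int m) + h (- int m) =
      (bessel_I (int m - int v) (2 * x) - bessel_I (int m + int v) (2 * x)) * cheb_diff N y m i" for m
    using bessel_I_minus[of "int m + int v" "2 * x"]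
    by (simp add: h_def cheb_diff_int_minus) (simp add: cheb_diff_int_def algebra_simps)
  ultimately show ?thesis by (simp add: S_def)
qed

lemma has_sum_exp_chi_det:
  assumes y: "\<And>i. cmod (y i) \<le> 2"
  shows "((\<lambda>n. Determinant.det (Matrix.mat N N (\<lambda>(i, j).
              bessel_I (int (n ! j) + int i - int j) (2 * x)
              - bessel_I (int (n ! j) + 2 * int N - int i - int j) (2 * x)))
            * chi_det N y (shifted_weight N n))
          has_sum exp (x * (\<Sum>i<N. y i))) (dominant_weights N)"
proof -
  \<comment> \<open>Row \<open>i\<close> belongs to the vector with index \<open>N - i\<close>, so
    subtracting that index from or adding it to the shifted weight gives the two Bessel orders of
    the theorem.\<close>
  define a where "a i m = bessel_I (int m - int (N - i)) (2 * x) - bessel_I (int m + int (N - i)) (2 * x)" for i m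
  define w where "w i j = (\<Sum>k<N. newton_exp x y j k * cheb_diff N y (N - i) k)" for i j
  have "((\<lambda>n. Determinant.det (Matrix.mat N N (\<lambda>(i, k). a i (shifted_weight N n k)))
      * Determinant.det (Matrix.mat N N (\<lambda>(k, j). cheb_diff N y (shifted_weight N n k) j)))
    has_sum Determinant.det (Matrix.mat N N (\<lambda>(i, j). w i j))) (dominant_weights N)"
    by (rule has_sum_Cauchy_Binet) (unfold a_def w_def, rule has_sum_newton_exp_cheb_diff[of y, OF y])
  moreover have "Determinant.det (Matrix.mat N N (\<lambda>(i, k). a i (shifted_weight N n k))) =
      Determinant.det (Matrix.mat N N (\<lambda>(i, j).
              bessel_I (int (n ! j) + int i - int j) (2 * x)
              - bessel_I (int (n ! j) + 2 * int N - int i - int j) (2 * x)))" for n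
    by (intro arg_cong[where f = Determinant.det] eq_matI)
      (auto simp: a_def shifted_weight_def of_nat_diff algebra_simps)
  moreover have "Determinant.det (Matrix.mat N N (\<lambda>(k, j). cheb_diff N y (shifted_weight N n k) j)) =
      chi_det N y (shifted_weight N n)" for n
    unfolding chi_det_def by (rule det_mat_swap)
  moreover have "Determinant.det (Matrix.mat N N (\<lambda>(i, j). w i j)) = exp (x * (\<Sum>i<N. y i))"
  proof -
    let ?E = "Matrix.mat N N (\<lambda>(i, k). newton_exp x y i k)"
    let ?V = "Matrix.mat N N (\<lambda>(k, j). cheb_diff N y (N - j) k)"
    have "Determinant.det (Matrix.mat N N (\<lambda>(i, j). w i j)) = Determinant.det (Matrix.mat N N (\<lambda>(i, j). w j i))"
      by (rule det_mat_swap[symmetric])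
    \<comment> \<open>Column \<open>j\<close> is \<open>exp(xJ)\<close> applied to the vector with
      index \<open>N - j\<close>.\<close>
    also have "Matrix.mat N N (\<lambda>(i, j). w j i) = ?E * ?V"
      by (rule eq_matI) (auto simp: scalar_prod_def w_def atLeast0LessThan)
    also have "Determinant.det (?E * ?V) = Determinant.det ?E * Determinant.det ?V"
      by (rule det_mult[of _ N]) auto
    also have "Determinant.det ?V = 1"
      using chi_det_staircase[of N y] by (simp add: chi_det_def)
    finally show ?thesis by (simp add: det_newton_exp[of y, OF y])
  qed
  ultimately show ?thesis by simp
qed

section \<open>Eigenvalues of compact symplectic matrices\<close>

lemma mat_trace_mult_commute:
  fixes A B :: "'a :: comm_semiring_0 mat"
  assumes "A \<in> carrier_mat n m" "B \<in> carrier_mat m n"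
  shows "mat_trace (A * B) = mat_trace (B * A)"
proof -
  have "mat_trace (A * B) = (\<Sum>i<n. \<Sum>j<m. A $$ (i, j) * B $$ (j, i))"
    using assms by (simp add: mat_trace_def scalar_prod_def atLeast0LessThan)
  also have "\<dots> = (\<Sum>j<m. \<Sum>i<n. A $$ (i, j) * B $$ (j, i))"
    by (rule sum.swap)
  also have "\<dots> = mat_trace (B * A)"
    using assms by (simp add: mat_trace_def scalar_prod_def atLeast0LessThan mult.commute)
  finally show ?thesis .
qed

text \<open>Schur triangularisation puts \<open>es\<close> on the diagonal, and the trace is
  invariant under similarity.\<close>

lemma mat_trace_eq_sum_eigenvalues:
  fixes A :: "complex mat"
  assumes A: "A \<in> carrier_mat n n" and c: "char_poly A = (\<Prod>e\<leftarrow>es. [:- e, 1:])"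
  shows "mat_trace A = sum_list es"
proof -
  obtain B P Q where s: "schur_decomposition A es = (B, P, Q)" by (metis prod_cases3)
  note sd = schur_decomposition[OF A c s]
  then have "similar_mat_wit A B P Q" and B: "diag_mat B = es" by auto
  note w = similar_mat_witD2[OF A this(1)]
  have "mat_trace A = mat_trace (P * (B * Q))"
    using w by (simp add: assoc_mult_mat[of P n n B n Q n])
  also have "\<dots> = mat_trace (B * Q * P)"
    by (rule mat_trace_mult_commute[of _ n n]) (use w in auto)
  also have "B * Q * P = B"
    using w by (simp add: assoc_mult_mat[of B n n Q n P n])
  also have "mat_trace B = sum_list (diag_mat B)"
    by (simp add: mat_trace_def diag_mat_def sum_list_sum_nth atLeast0LessThan)
  finally show ?thesis by (simp add: B)
qed

section \<open>Unitary matrices and orthonormal eigenvectors\<close>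

lemma scalar_prod_mult_mat_vec:
  fixes A :: "'a :: comm_semiring_0 mat"
  assumes "A \<in> carrier_mat n n" "v \<in> carrier_vec n" "u \<in> carrier_vec n"
  shows "(A *\<^sub>v v) \<bullet> u = v \<bullet> (transpose_mat A *\<^sub>v u)"
  using transpose_vec_mult_scalar[of A n n v u] assms
  by (metis comm_scalar_prod mult_mat_vec_carrier transpose_carrier_mat)

definition conj_mat :: "complex mat \<Rightarrow> complex mat" where
  "conj_mat A = map_mat cnj A"

lemma conjugate_mult_mat_vec:
  fixes A :: "complex mat"
  assumes "A \<in> carrier_mat n n" "v \<in> carrier_vec n"
  shows "conjugate (A *\<^sub>v v) = conj_mat A *\<^sub>v conjugate v"
  by (rule eq_vecI) (use assms in \<open>auto simp: conj_mat_def scalar_prod_def\<close>)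

lemma mat_adjoint_alt: "mat_adjoint A = transpose_mat (conj_mat A)" for A :: "complex mat"
  by (rule eq_matI)
    (auto simp: mat_adjoint_def conj_mat_def mat_of_rows_index)

lemma unitary_conj_mat:
  fixes P :: "complex mat"
  assumes P: "P \<in> carrier_mat n n" "mat_adjoint P * P = 1\<^sub>m n"
  shows "transpose_mat P * conj_mat P = 1\<^sub>m n" "conj_mat P * transpose_mat P = 1\<^sub>m n"
proof -
  have "conj_mat (mat_adjoint P * P) = transpose_mat P * conj_mat P"
    by (rule eq_matI)
      (use P(1) in \<open>auto simp: mat_adjoint_alt conj_mat_def scalar_prod_def mult.commute\<close>)
  moreover have "conj_mat (1\<^sub>m n) = 1\<^sub>m n"
    by (rule eq_matI) (auto simp: conj_mat_def)
  ultimately show 1: "transpose_mat P * conj_mat P = 1\<^sub>m n"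
    using P(2) by simp
  show "conj_mat P * transpose_mat P = 1\<^sub>m n"
    by (rule mat_mult_left_right_inverse[OF _ _ 1]) (use P in \<open>auto simp: conj_mat_def\<close>)
qed

lemma unitary_cscalar_prod:
  fixes P :: "complex mat"
  assumes P: "P \<in> carrier_mat n n" "mat_adjoint P * P = 1\<^sub>m n"
    and v: "v \<in> carrier_vec n" "u \<in> carrier_vec n"
  shows "(P *\<^sub>v v) \<bullet>c (P *\<^sub>v u) = v \<bullet>c u"
proof -
  have c: "conj_mat P \<in> carrier_mat n n" using P by (simp add: conj_mat_def)
  have "(P *\<^sub>v v) \<bullet>c (P *\<^sub>v u) = v \<bullet> (transpose_mat P *\<^sub>v (conj_mat P *\<^sub>v conjugate u))"
    using P v c by (simp add: conjugate_mult_mat_vec[of _ n] scalar_prod_mult_mat_vec[of _ n])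
  also have "transpose_mat P *\<^sub>v (conj_mat P *\<^sub>v conjugate u) = (transpose_mat P * conj_mat P) *\<^sub>v conjugate u"
    by (rule assoc_mult_mat_vec[symmetric]) (use P v c in auto)
  also have "\<dots> = conjugate u"
    using unitary_conj_mat(1)[OF P] v by simp
  finally show ?thesis .
qed

text \<open>The \<open>k\<close> conditions, padded with zero rows, form a singular square matrix:
  every Leibniz product contains an entry of the zero row \<open>k\<close>.\<close>

lemma exists_orthogonal_vec:
  fixes u :: "nat \<Rightarrow> complex vec"
  assumes "k < n" "\<And>i. i < k \<Longrightarrow> u i \<in> carrier_vec n"
  obtains w where "w \<in> carrier_vec n" "w \<noteq> 0\<^sub>v n" "\<And>i. i < k \<Longrightarrow> w \<bullet>c u i = 0"
proof -
  define M where "M = Matrix.mat n n (\<lambda>(i, b). if i < k then cnj (u i $ b) else 0)"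
  have "(\<Prod>i = 0..<n. M $$ (i, p i)) = 0" if p: "p permutes {0..<n}" for p
    using assms(1) permutes_in_image[OF p] by (intro prod_zero bexI[of _ k]) (auto simp: M_def)
  moreover have M: "M \<in> carrier_mat n n" by (simp add: M_def)
  ultimately have "Determinant.det M = 0"
    by (simp only: det_def'[OF M]) (rule sum.neutral, simp)
  then obtain w where w: "w \<in> carrier_vec n" "w \<noteq> 0\<^sub>v n" "M *\<^sub>v w = 0\<^sub>v n"
    using det_0_iff_vec_prod_zero_field[OF M] by auto
  have "w \<bullet>c u i = 0" if i: "i < k" for i
  proof -
    have "w \<bullet>c u i = (M *\<^sub>v w) $ i"
      using i assms(1) assms(2)[OF i] w(1) by (auto simp: M_def scalar_prod_def mult.commute)
    then show ?thesis using w i assms(1) by simp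
  qed
  with w that show thesis by blast
qed

lemma unitary_eigenvalue_norm:
  fixes P :: "complex mat"
  assumes P: "P \<in> carrier_mat n n" "mat_adjoint P * P = 1\<^sub>m n"
    and v: "v \<in> carrier_vec n" "v \<bullet>c v \<noteq> 0" "P *\<^sub>v v = l \<cdot>\<^sub>v v"
  shows "l * cnj l = 1"
proof -
  have "v \<bullet>c v = (l \<cdot>\<^sub>v v) \<bullet>c (l \<cdot>\<^sub>v v)"
    using unitary_cscalar_prod[OF P v(1) v(1)] v(3) by simp
  also have "\<dots> = (l * cnj l) * (v \<bullet>c v)"
    using v(1) by (simp add: conjugate_smult_vec)
  finally show ?thesis using v(2) by simp
qed

text \<open>Removing the known eigenvectors from \<open>P\<close> by a rank \<open>k\<close> correction keeps \<open>P\<close> on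
  their orthogonal complement and maps everything into that complement. The corrected matrix
  is injective on the complement, so it cannot be strictly triangularisable and has a nonzero
  eigenvalue.\<close>

lemma unitary_extend_eigenvectors:
  fixes P :: "complex mat"
  assumes P: "P \<in> carrier_mat n n" "mat_adjoint P * P = 1\<^sub>m n"
    and k: "k < n" and u: "\<And>i. i < k \<Longrightarrow> u i \<in> carrier_vec n"
    and eig: "\<And>i. i < k \<Longrightarrow> P *\<^sub>v u i = l i \<cdot>\<^sub>v u i"
    and orth: "\<And>i j. i < k \<Longrightarrow> j < k \<Longrightarrow> u i \<bullet>c u j = (if i = j then 1 else 0)"
  obtains v c where "v \<in> carrier_vec n" "v \<noteq> 0\<^sub>v n" "\<And>i. i < k \<Longrightarrow> v \<bullet>c u i = 0"
    "P *\<^sub>v v = c \<cdot>\<^sub>v v"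
proof -
  define R where "R = Matrix.mat n n (\<lambda>(a, b). P $$ (a, b) - (\<Sum>i<k. l i * u i $ a * cnj (u i $ b)))"
  have R: "R \<in> carrier_mat n n" by (simp add: R_def)
  have R_vec: "(R *\<^sub>v w) $ a = (P *\<^sub>v w) $ a - (\<Sum>i<k. l i * (w \<bullet>c u i) * u i $ a)"
    if w: "w \<in> carrier_vec n" and a: "a < n" for w a
  proof -
    have "(R *\<^sub>v w) $ a = (P *\<^sub>v w) $ a - (\<Sum>b<n. \<Sum>i<k. l i * u i $ a * cnj (u i $ b) * w $ b)"
      using w a P(1) by (simp add: R_def scalar_prod_def sum_subtractf algebra_simps
          sum_distrib_left sum_distrib_right atLeast0LessThan)
    also have "(\<Sum>b<n. \<Sum>i<k. l i * u i $ a * cnj (u i $ b) * w $ b) =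
        (\<Sum>i<k. \<Sum>b<n. l i * u i $ a * cnj (u i $ b) * w $ b)"
      by (rule sum.swap)
    also have "\<dots> = (\<Sum>i<k. l i * (w \<bullet>c u i) * u i $ a)"
    proof (rule sum.cong[OF refl])
      fix i assume "i \<in> {..<k}"
      then have "w \<bullet>c u i = (\<Sum>b<n. w $ b * cnj (u i $ b))"
        using u[of i] by (auto simp: scalar_prod_def atLeast0LessThan)
      then show "(\<Sum>b<n. l i * u i $ a * cnj (u i $ b) * w $ b) = l i * (w \<bullet>c u i) * u i $ a"
        by (simp add: sum_distrib_left sum_distrib_right algebra_simps)
    qed
    finally show ?thesis .
  qed
  have l: "l i * cnj (l i) = 1" if "i < k" for i
    using unitary_eigenvalue_norm[OF P u[OF that] _ eig[OF that]] orth[of i i] that by simp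
  \<comment> \<open>\<open>P\<close> preserves the inner product and \<open>l i\<close> has modulus
    one, so the orthogonal complement of the \<open>u i\<close> is invariant under
    \<open>P\<close>.\<close>
  have Pu: "(P *\<^sub>v w) \<bullet>c u i = l i * (w \<bullet>c u i)" if w: "w \<in> carrier_vec n" and i: "i < k" for w i
  proof -
    have "w \<bullet>c u i = (P *\<^sub>v w) \<bullet>c (l i \<cdot>\<^sub>v u i)"
      using unitary_cscalar_prod[OF P w u[OF i]] eig[OF i] by simp
    also have "\<dots> = cnj (l i) * ((P *\<^sub>v w) \<bullet>c u i)"
      using w u[OF i] P(1) by (simp add: conjugate_smult_vec)
    finally have "l i * (w \<bullet>c u i) = (l i * cnj (l i)) * ((P *\<^sub>v w) \<bullet>c u i)" by simp
    then show ?thesis using l[OF i] by simp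
  qed
  have R_perp: "(R *\<^sub>v w) \<bullet>c u j = 0" if w: "w \<in> carrier_vec n" and j: "j < k" for w j
  proof -
    have "(R *\<^sub>v w) \<bullet>c u j = (\<Sum>a<n. (R *\<^sub>v w) $ a * cnj (u j $ a))"
      using u[OF j] by (auto simp: scalar_prod_def atLeast0LessThan)
    also have "\<dots> = (\<Sum>a<n. (P *\<^sub>v w) $ a * cnj (u j $ a)) -
        (\<Sum>a<n. \<Sum>i<k. l i * (w \<bullet>c u i) * (u i $ a * cnj (u j $ a)))"
      by (simp add: R_vec[OF w] sum_subtractf left_diff_distrib sum_distrib_right mult.assoc)
    also have "(\<Sum>a<n. \<Sum>i<k. l i * (w \<bullet>c u i) * (u i $ a * cnj (u j $ a))) =
        (\<Sum>i<k. \<Sum>a<n. l i * (w \<bullet>c u i) * (u i $ a * cnj (u j $ a)))"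
      by (rule sum.swap)
    also have "\<dots> = (\<Sum>i<k. l i * (w \<bullet>c u i) * (u i \<bullet>c u j))"
      by (rule sum.cong) (use u[OF j] in \<open>auto simp: scalar_prod_def sum_distrib_left atLeast0LessThan\<close>)
    also have "\<dots> = (\<Sum>i<k. if i = j then l i * (w \<bullet>c u i) else 0)"
      by (rule sum.cong) (use orth j in auto)
    also have "\<dots> = l j * (w \<bullet>c u j)" using j by simp
    also have "(\<Sum>a<n. (P *\<^sub>v w) $ a * cnj (u j $ a)) = (P *\<^sub>v w) \<bullet>c u j"
      using u[OF j] by (auto simp: scalar_prod_def atLeast0LessThan)
    finally show ?thesis by (simp add: Pu[OF w j])
  qed
  have R_eq: "R *\<^sub>v w = P *\<^sub>v w" if w: "w \<in> carrier_vec n" and perp: "\<And>i. i < k \<Longrightarrow> w \<bullet>c u i = 0" for w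
    by (rule eq_vecI) (use R_vec[OF w] perp P(1) R in auto)
  obtain es where es: "char_poly R = (\<Prod>e\<leftarrow>es. [:- e, 1:])" "length es = n"
    using char_poly_factorized[OF R] by blast
  show thesis
  proof (cases "\<exists>e\<in>set es. e \<noteq> 0")
    case True
    then obtain e where e: "e \<in> set es" "e \<noteq> 0" by blast
    have "poly (char_poly R) e = 0"
      using e(1) unfolding es by (induction es) auto
    then have "eigenvalue R e" using eigenvalue_root_char_poly[OF R] by simp
    then obtain v where v: "v \<in> carrier_vec n" "v \<noteq> 0\<^sub>v n" "R *\<^sub>v v = e \<cdot>\<^sub>v v"
      using R by (auto simp: eigenvalue_def eigenvector_def)
    have perp: "v \<bullet>c u i = 0" if "i < k" for i
      using R_perp[OF v(1) that] v u[OF that] e(2) by simp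
    show thesis
      by (rule that[of v e]) (use v perp R_eq[OF v(1) perp] in auto)
  next
    case False
    obtain B W Q where s: "schur_decomposition R es = (B, W, Q)" by (metis prod_cases3)
    note sd = schur_decomposition[OF R es(1) s]
    then have "similar_mat_wit R B W Q" and B: "diag_mat B = es" "upper_triangular B" by auto
    note w = similar_mat_witD2[OF R this(1)]
    have B0: "B $$ (i, j) = 0" if "j \<le> i" "i < n" for i j
    proof (cases "j = i")
      case True
      have "B $$ (i, i) = es ! i" using B(1) w(5) that by (auto simp: diag_mat_def)
      then show ?thesis using False es(2) that True by simp
    next
      case False
      then show ?thesis using B(2) w(5) that by auto
    qed
    \<comment> \<open>\<open>B\<close> is strictly upper triangular, so \<open>R\<close> lengthens
      the run of zeros at the end of \<open>Q *\<^sub>v v\<close> by one. Induction gives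
      \<open>R *\<^sub>v v = 0\<close>; on the complement \<open>R\<close> is \<open>P\<close>,
      which preserves norms, so \<open>v\<close> is zero.\<close>
    have "v = 0\<^sub>v n" if "v \<in> carrier_vec n" "\<And>i. i < k \<Longrightarrow> v \<bullet>c u i = 0"
      "\<And>i. h \<le> i \<Longrightarrow> i < n \<Longrightarrow> (Q *\<^sub>v v) $ i = 0" for h v
      using that
    proof (induction h arbitrary: v)
      case 0
      have "Q *\<^sub>v v = 0\<^sub>v n" by (rule eq_vecI) (use 0 w in auto)
      then have "W *\<^sub>v (Q *\<^sub>v v) = 0\<^sub>v n" using w by (auto intro!: eq_vecI)
      then show ?case
        using w 0 assoc_mult_mat_vec[of W n n Q n v] by simp
    next
      case (Suc h)
      have Rv: "R *\<^sub>v v = 0\<^sub>v n"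
      proof (rule Suc.IH)
        show "R *\<^sub>v v \<in> carrier_vec n" using R Suc.prems by auto
        show "(R *\<^sub>v v) \<bullet>c u i = 0" if "i < k" for i using R_perp Suc.prems that by blast
        fix i assume i: "h \<le> i" "i < n"
        have "Q * R = B * Q"
        proof -
          have "Q * R = Q * (W * (B * Q))"
            using w by (simp add: assoc_mult_mat[of W n n B n Q n])
          also have "\<dots> = Q * W * (B * Q)"
            by (rule assoc_mult_mat[symmetric]) (use w in auto)
          finally show ?thesis using w by simp
        qed
        then have "Q *\<^sub>v (R *\<^sub>v v) = B *\<^sub>v (Q *\<^sub>v v)"
          using assoc_mult_mat_vec[of Q n n R n v] assoc_mult_mat_vec[of B n n Q n v] w R Suc.prems
          by simp
        moreover have "(B *\<^sub>v (Q *\<^sub>v v)) $ i = (\<Sum>j<n. B $$ (i, j) * (Q *\<^sub>v v) $ j)"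
          using w i Suc.prems by (simp add: scalar_prod_def atLeast0LessThan)
        moreover have "\<dots> = 0"
        proof (rule sum.neutral, rule ballI)
          fix j assume "j \<in> {..<n}"
          then show "B $$ (i, j) * (Q *\<^sub>v v) $ j = 0"
            using B0[of j i] Suc.prems(3)[of j] i by (cases "j \<le> i") auto
        qed
        ultimately show "(Q *\<^sub>v (R *\<^sub>v v)) $ i = 0" by simp
      qed
      have "v \<bullet>c v = (P *\<^sub>v v) \<bullet>c (P *\<^sub>v v)"
        using unitary_cscalar_prod[OF P] Suc.prems by simp
      also have "P *\<^sub>v v = 0\<^sub>v n" using R_eq Suc.prems Rv by metis
      finally have "v \<bullet>c v = 0" by simp
      then show ?case using conjugate_square_eq_0_vec[OF Suc.prems(1)] by simp
    qed
    \<comment> \<open>For \<open>h = n\<close> the condition on coordinates is empty: the whole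
      complement would be zero, against \<open>k < n\<close>.\<close>
    note inj = this[where h = n]
    obtain z where z: "z \<in> carrier_vec n" "z \<noteq> 0\<^sub>v n" "\<And>i. i < k \<Longrightarrow> z \<bullet>c u i = 0"
      by (rule exists_orthogonal_vec[of k n u, OF k]) (use u in blast)+
    then show thesis using inj[of z] by auto
  qed
qed

section \<open>The symplectic form and the quaternionic structure\<close>

lemma symplectic_form_carrier: "symplectic_form N \<in> carrier_mat (2 * N) (2 * N)"
  unfolding symplectic_form_def mult_2 by (rule four_block_carrier_mat) auto

lemma symplectic_form_transpose: "transpose_mat (symplectic_form N) = - symplectic_form N"
  by (rule eq_matI) (auto simp: symplectic_form_def)

lemma symplectic_form_conj: "conj_mat (symplectic_form N) = symplectic_form N"
  by (rule eq_matI) (auto simp: symplectic_form_def conj_mat_def)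

lemma symplectic_form_square: "symplectic_form N * symplectic_form N = - 1\<^sub>m (2 * N)"
proof -
  have "symplectic_form N * symplectic_form N =
      four_block_mat (- 1\<^sub>m N) (0\<^sub>m N N) (0\<^sub>m N N) (- 1\<^sub>m N)"
    unfolding symplectic_form_def
    by (subst mult_four_block_mat[of _ N N _ N _ N _ _ N _ N]) auto
  also have "\<dots> = - 1\<^sub>m (2 * N)"
    by (rule eq_matI) auto
  finally show ?thesis .
qed

text \<open>An antilinear map of square -1: multiplication by the unit j when the space is regarded
  as quaternionic of dimension \<open>N\<close>.\<close>

definition quaternionic_conj :: "nat \<Rightarrow> complex vec \<Rightarrow> complex vec" where
  "quaternionic_conj N v = symplectic_form N *\<^sub>v conjugate v"

lemma quaternionic_conj_carrier:
  "v \<in> carrier_vec (2 * N) \<Longrightarrow> quaternionic_conj N v \<in> carrier_vec (2 * N)"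
  using symplectic_form_carrier[of N] by (simp add: quaternionic_conj_def)

lemma conjugate_quaternionic_conj:
  "v \<in> carrier_vec (2 * N) \<Longrightarrow> conjugate (quaternionic_conj N v) = symplectic_form N *\<^sub>v v"
  using symplectic_form_carrier[of N]
  by (simp add: quaternionic_conj_def conjugate_mult_mat_vec[of _ "2 * N"] symplectic_form_conj)

lemma uminus_one_mult_vec: "(v :: complex vec) \<in> carrier_vec n \<Longrightarrow> (- 1\<^sub>m n) *\<^sub>v v = - v"
  by (rule eq_vecI) auto

lemma scalar_prod_symplectic_form:
  assumes "v \<in> carrier_vec (2 * N)" "u \<in> carrier_vec (2 * N)"
  shows "v \<bullet> (symplectic_form N *\<^sub>v u) = - ((symplectic_form N *\<^sub>v v) \<bullet> u)"
  using assms symplectic_form_carrier[of N]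
    scalar_prod_mult_mat_vec[OF symplectic_form_carrier assms]
  by (simp add: symplectic_form_transpose)

lemma quaternionic_conj_twice:
  assumes "v \<in> carrier_vec (2 * N)"
  shows "quaternionic_conj N (quaternionic_conj N v) = - v"
proof -
  have "quaternionic_conj N (quaternionic_conj N v) = symplectic_form N *\<^sub>v (symplectic_form N *\<^sub>v v)"
    using conjugate_quaternionic_conj[OF assms] by (simp add: quaternionic_conj_def)
  also have "\<dots> = (symplectic_form N * symplectic_form N) *\<^sub>v v"
    by (rule assoc_mult_mat_vec[symmetric]) (use symplectic_form_carrier[of N] assms in auto)
  also have "\<dots> = - v"
    unfolding symplectic_form_square by (rule uminus_one_mult_vec[OF assms])
  finally show ?thesis .
qed

lemma cscalar_prod_swap:
  "v \<in> carrier_vec n \<Longrightarrow> u \<in> carrier_vec n \<Longrightarrow> v \<bullet>c u = cnj (u \<bullet>c v)" for v u :: "complex vec"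
  by (auto simp: scalar_prod_def mult.commute)

text \<open>The symplectic form is real and antisymmetric, which gives the first identity; the
  others follow from conjugate symmetry and \<open>quaternionic_conj_twice\<close>.\<close>

lemma quaternionic_conj_cscalar_prod:
  assumes "v \<in> carrier_vec (2 * N)" "u \<in> carrier_vec (2 * N)"
  shows "v \<bullet>c quaternionic_conj N u = - (u \<bullet>c quaternionic_conj N v)"
    and "quaternionic_conj N v \<bullet>c u = - cnj (v \<bullet>c quaternionic_conj N u)"
    and "quaternionic_conj N v \<bullet>c quaternionic_conj N u = cnj (v \<bullet>c u)"
proof -
  have 1: "v \<bullet>c quaternionic_conj N u = - (u \<bullet>c quaternionic_conj N v)"
    if "v \<in> carrier_vec (2 * N)" "u \<in> carrier_vec (2 * N)" for v u
  proof -
    have c: "symplectic_form N *\<^sub>v v \<in> carrier_vec (2 * N)"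
      using symplectic_form_carrier[of N] that by simp
    show ?thesis
      using that by (simp add: conjugate_quaternionic_conj scalar_prod_symplectic_form
          comm_scalar_prod[OF c])
  qed
  show "v \<bullet>c quaternionic_conj N u = - (u \<bullet>c quaternionic_conj N v)"
    using 1 assms by blast
  have 2: "quaternionic_conj N v \<bullet>c u = - cnj (v \<bullet>c quaternionic_conj N u)"
    if "v \<in> carrier_vec (2 * N)" "u \<in> carrier_vec (2 * N)" for v u
    using cscalar_prod_swap[OF quaternionic_conj_carrier[OF that(1)] that(2)] 1[OF that(2,1)] by simp
  show "quaternionic_conj N v \<bullet>c u = - cnj (v \<bullet>c quaternionic_conj N u)"
    using 2 assms by blast
  have "v \<bullet>c quaternionic_conj N (quaternionic_conj N u) = - (v \<bullet>c u)"
    using assms by (simp add: quaternionic_conj_twice) (auto simp: scalar_prod_def sum_negf)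
  then show "quaternionic_conj N v \<bullet>c quaternionic_conj N u = cnj (v \<bullet>c u)"
    using 2[OF assms(1) quaternionic_conj_carrier[OF assms(2)]] by simp
qed

text \<open>Unitarity makes \<open>conj_mat P\<close> the inverse of the transpose. Cancelling the
  transpose in the symplectic condition and conjugating gives the claim, since the form is
  real.\<close>

lemma compact_symplectic_commutes:
  assumes "P \<in> compact_symplectic_group N"
  shows "P * symplectic_form N = symplectic_form N * conj_mat P"
proof -
  let ?O = "symplectic_form N" and ?n = "2 * N"
  have P: "P \<in> carrier_mat ?n ?n" "mat_adjoint P * P = 1\<^sub>m ?n" "transpose_mat P * ?O * P = ?O"
    using assms by (auto simp: compact_symplectic_group_def)
  have O: "?O \<in> carrier_mat ?n ?n" by (rule symplectic_form_carrier)
  have C: "conj_mat P \<in> carrier_mat ?n ?n" using P(1) by (simp add: conj_mat_def)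
  have T: "transpose_mat P \<in> carrier_mat ?n ?n" using P(1) by simp
  have "conj_mat P * ?O = conj_mat P * (transpose_mat P * (?O * P))"
    using P(3) assoc_mult_mat[OF T O P(1)] by simp
  also have "\<dots> = (conj_mat P * transpose_mat P) * (?O * P)"
    by (rule assoc_mult_mat[symmetric]) (use C T O P(1) in auto)
  also have "\<dots> = ?O * P"
    using unitary_conj_mat(2)[OF P(1,2)] O P(1) by simp
  finally have "conj_mat (conj_mat P * ?O) = conj_mat (?O * P)" by simp
  moreover have "conj_mat (A * B) = conj_mat A * conj_mat B"
    if "A \<in> carrier_mat ?n ?n" "B \<in> carrier_mat ?n ?n" for A B
    by (rule eq_matI) (use that in \<open>auto simp: conj_mat_def scalar_prod_def\<close>)
  moreover have "conj_mat (conj_mat P) = P" by (rule eq_matI) (auto simp: conj_mat_def)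
  ultimately show ?thesis using C O P(1) by (simp add: symplectic_form_conj)
qed

text \<open>\<open>P\<close> commutes with \<open>quaternionic_conj N\<close>, whose antilinearity
  conjugates the eigenvalue.\<close>

lemma compact_symplectic_quaternionic_conj_eigenvector:
  assumes "P \<in> compact_symplectic_group N" "v \<in> carrier_vec (2 * N)" "P *\<^sub>v v = c \<cdot>\<^sub>v v"
  shows "P *\<^sub>v quaternionic_conj N v = cnj c \<cdot>\<^sub>v quaternionic_conj N v"
proof -
  let ?O = "symplectic_form N" and ?n = "2 * N"
  have P: "P \<in> carrier_mat ?n ?n" using assms by (auto simp: compact_symplectic_group_def)
  have O: "?O \<in> carrier_mat ?n ?n" by (rule symplectic_form_carrier)
  have C: "conj_mat P \<in> carrier_mat ?n ?n" using P(1) by (simp add: conj_mat_def)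
  have "P *\<^sub>v quaternionic_conj N v = (P * ?O) *\<^sub>v conjugate v"
    using assoc_mult_mat_vec[OF P O, of "conjugate v"] assms by (simp add: quaternionic_conj_def)
  also have "\<dots> = ?O *\<^sub>v (conj_mat P *\<^sub>v conjugate v)"
    using assoc_mult_mat_vec[OF O C, of "conjugate v"] assms
    by (simp add: compact_symplectic_commutes[OF assms(1)])
  also have "conj_mat P *\<^sub>v conjugate v = cnj c \<cdot>\<^sub>v conjugate v"
    using conjugate_mult_mat_vec[OF P assms(2)] assms(3) by (simp add: conjugate_smult_vec)
  also have "?O *\<^sub>v (cnj c \<cdot>\<^sub>v conjugate v) = cnj c \<cdot>\<^sub>v (?O *\<^sub>v conjugate v)"
    by (rule mult_mat_vec[OF O]) (use assms in simp)
  finally show ?thesis by (simp add: quaternionic_conj_def)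
qed

section \<open>The eigenbasis and the pairing of eigenvalues\<close>

text \<open>The vectors found so far and their quaternionic conjugates are \<open>2 * m\<close>
  orthonormal eigenvectors. While \<open>m < N\<close> there is an eigenvector orthogonal to all of
  them, and its conjugate stays orthogonal to them too.\<close>

lemma compact_symplectic_eigenbasis:
  assumes P: "P \<in> compact_symplectic_group N" and "m \<le> N"
  shows "\<exists>v t. (\<forall>i<m. v i \<in> carrier_vec (2 * N) \<and> P *\<^sub>v v i = t i \<cdot>\<^sub>v v i) \<and>
    (\<forall>i<m. \<forall>j<m. v i \<bullet>c v j = (if i = j then 1 else 0) \<and> v i \<bullet>c quaternionic_conj N (v j) = 0)"
  using assms(2)
proof (induction m)
  case (Suc m)
  let ?n = "2 * N" and ?q = "quaternionic_conj N"
  have P': "P \<in> carrier_mat ?n ?n" "mat_adjoint P * P = 1\<^sub>m ?n"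
    using P by (auto simp: compact_symplectic_group_def)
  obtain v t where vt: "\<forall>i<m. v i \<in> carrier_vec ?n \<and> P *\<^sub>v v i = t i \<cdot>\<^sub>v v i"
    "\<forall>i<m. \<forall>j<m. v i \<bullet>c v j = (if i = j then 1 else 0) \<and> v i \<bullet>c ?q (v j) = 0"
    using Suc.IH[OF Suc_leD[OF Suc.prems]] by blast
  then have v: "\<And>i. i < m \<Longrightarrow> v i \<in> carrier_vec ?n"
    "\<And>i. i < m \<Longrightarrow> P *\<^sub>v v i = t i \<cdot>\<^sub>v v i"
    "\<And>i j. i < m \<Longrightarrow> j < m \<Longrightarrow> v i \<bullet>c v j = (if i = j then 1 else 0)"
    "\<And>i j. i < m \<Longrightarrow> j < m \<Longrightarrow> v i \<bullet>c ?q (v j) = 0"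
    by blast+
  define u where "u i = (if i < m then v i else ?q (v (i - m)))" for i
  define l where "l i = (if i < m then t i else cnj (t (i - m)))" for i
  have qv: "?q (v i) \<in> carrier_vec ?n" if "i < m" for i
    by (rule quaternionic_conj_carrier[OF v(1)[OF that]])
  obtain w c where w: "w \<in> carrier_vec ?n" "w \<noteq> 0\<^sub>v ?n"
    "\<And>i. i < 2 * m \<Longrightarrow> w \<bullet>c u i = 0" "P *\<^sub>v w = c \<cdot>\<^sub>v w"
  proof (rule unitary_extend_eigenvectors[OF P', of "2 * m" u l])
    show "2 * m < 2 * N" using Suc by simp
    show "u i \<in> carrier_vec ?n" if "i < 2 * m" for i
      using that by (auto simp: u_def v qv)
    show "P *\<^sub>v u i = l i \<cdot>\<^sub>v u i" if "i < 2 * m" for i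
      using that by (auto simp: u_def l_def v
          compact_symplectic_quaternionic_conj_eigenvector[OF P v(1,2)])
    show "u i \<bullet>c u j = (if i = j then 1 else 0)" if "i < 2 * m" "j < 2 * m" for i j
      using that v(3)[of i j] v(3)[of "i - m" "j - m"]
      by (auto simp: u_def v(4) quaternionic_conj_cscalar_prod(2,3)[OF v(1) v(1)])
  qed auto
  define s where "s = w \<bullet>c w"
  have "s \<noteq> 0" using w by (simp add: s_def)
  have "0 \<le> s" unfolding s_def by (rule conjugate_square_ge_0_vec)
  then obtain r where r: "s = complex_of_real r" "0 \<le> r"
    by (metis complex_eq_iff less_eq_complex_def Re_complex_of_real Im_complex_of_real zero_complex.sel)
  define g where "g = complex_of_real (1 / sqrt r)"
  define z where "z = g \<cdot>\<^sub>v w"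
  have z: "z \<in> carrier_vec ?n" using w by (simp add: z_def)
  have zz: "z \<bullet>c z = 1"
  proof -
    have "z \<bullet>c z = g * cnj g * s"
      using w by (simp add: z_def s_def conjugate_smult_vec)
    also have "\<dots> = complex_of_real (1 / sqrt r * (1 / sqrt r) * r)"
      by (simp only: g_def r complex_cnj_complex_of_real of_real_mult)
    also have "1 / sqrt r * (1 / sqrt r) * r = 1"
      using r \<open>s \<noteq> 0\<close> by (simp add: field_simps)
    finally show ?thesis by simp
  qed
  have zv: "z \<bullet>c v i = 0" and zq: "z \<bullet>c ?q (v i) = 0" if "i < m" for i
    using w(1) w(3)[of i] w(3)[of "i + m"] that v(1)[OF that] qv[OF that]
    by (auto simp: z_def u_def)
  have vz: "v i \<bullet>c z = 0" and vq: "v i \<bullet>c ?q z = 0" if "i < m" for i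
    using cscalar_prod_swap[OF v(1)[OF that] z] zv[OF that]
      quaternionic_conj_cscalar_prod(1)[OF v(1)[OF that] z] zq[OF that] by simp_all
  \<comment> \<open>Antisymmetry makes this product its own negative. Thus even a real eigenvalue, 1
    or -1, comes with two independent eigenvectors.\<close>
  have "z \<bullet>c ?q z = 0"
    using quaternionic_conj_cscalar_prod(1)[OF z z] by simp
  moreover have "P *\<^sub>v z = c \<cdot>\<^sub>v z"
    using w P'(1) by (simp add: z_def mult_mat_vec[OF P'(1)] smult_smult_assoc mult.commute)
  ultimately show ?case using v z zz zv zq vz vq
    by (intro exI[of _ "v(m := z)"] exI[of _ "t(m := c)"]) (auto simp: less_Suc_eq)
qed auto

lemma symplectic_eigenvalues_exist:
  assumes P: "P \<in> compact_symplectic_group N"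
  shows "\<exists>t. symplectic_eigenvalues N P t"
proof -
  let ?n = "2 * N" and ?q = "quaternionic_conj N"
  have P': "P \<in> carrier_mat ?n ?n" "mat_adjoint P * P = 1\<^sub>m ?n"
    using P by (auto simp: compact_symplectic_group_def)
  obtain v t where vt: "\<forall>i<N. v i \<in> carrier_vec ?n \<and> P *\<^sub>v v i = t i \<cdot>\<^sub>v v i"
    "\<forall>i<N. \<forall>j<N. v i \<bullet>c v j = (if i = j then 1 else 0) \<and> v i \<bullet>c ?q (v j) = 0"
    using compact_symplectic_eigenbasis[OF P order_refl] by blast
  then have v: "\<And>i. i < N \<Longrightarrow> v i \<in> carrier_vec ?n"
    "\<And>i. i < N \<Longrightarrow> P *\<^sub>v v i = t i \<cdot>\<^sub>v v i"
    "\<And>i j. i < N \<Longrightarrow> j < N \<Longrightarrow> v i \<bullet>c v j = (if i = j then 1 else 0)"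
    "\<And>i j. i < N \<Longrightarrow> j < N \<Longrightarrow> v i \<bullet>c ?q (v j) = 0"
    by blast+
  define u where "u i = (if i < N then v i else ?q (v (i - N)))" for i
  define l where "l i = (if i < N then t i else cnj (t (i - N)))" for i
  have u: "u i \<in> carrier_vec ?n" if "i < ?n" for i
    using that by (auto simp: u_def v quaternionic_conj_carrier)
  have Pu: "P *\<^sub>v u i = l i \<cdot>\<^sub>v u i" if "i < ?n" for i
    using that by (auto simp: u_def l_def v
        compact_symplectic_quaternionic_conj_eigenvector[OF P v(1,2)])
  have uu: "u i \<bullet>c u j = (if i = j then 1 else 0)" if "i < ?n" "j < ?n" for i j
    using that v(3)[of i j] v(3)[of "i - N" "j - N"]
    by (auto simp: u_def v(4) quaternionic_conj_cscalar_prod(2,3)[OF v(1) v(1)])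
  \<comment> \<open>The columns of \<open>U\<close> are the eigenbasis, \<open>V\<close> is the
    adjoint of \<open>U\<close> and \<open>D\<close> holds the eigenvalues; \<open>P\<close> is
    diagonalised as \<open>U * D * V\<close>.\<close>
  define U where "U = Matrix.mat ?n ?n (\<lambda>(a, b). u b $ a)"
  define V where "V = Matrix.mat ?n ?n (\<lambda>(a, b). cnj (u a $ b))"
  define D where "D = Matrix.mat ?n ?n (\<lambda>(a, b). if a = b then l a else 0)"
  have carr: "U \<in> carrier_mat ?n ?n" "V \<in> carrier_mat ?n ?n" "D \<in> carrier_mat ?n ?n"
    by (simp_all add: U_def V_def D_def)
  have VU: "V * U = 1\<^sub>m ?n"
  proof (rule eq_matI)
    fix i j assume "i < dim_row (1\<^sub>m ?n :: complex mat)" "j < dim_col (1\<^sub>m ?n :: complex mat)"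
    then have ij: "i < ?n" "j < ?n" by auto
    have "(V * U) $$ (i, j) = u j \<bullet>c u i"
      using ij u[OF ij(1)] u[OF ij(2)] by (auto simp: V_def U_def scalar_prod_def mult.commute)
    then show "(V * U) $$ (i, j) = 1\<^sub>m ?n $$ (i, j)" using uu[OF ij(2,1)] ij by auto
  qed (use carr in auto)
  then have UV: "U * V = 1\<^sub>m ?n"
    by (rule mat_mult_left_right_inverse[OF carr(2,1)])
  have "P * U = U * D"
  proof (rule eq_matI)
    fix a b assume "a < dim_row (U * D)" "b < dim_col (U * D)"
    then have ab: "a < ?n" "b < ?n" using carr by auto
    have "(P * U) $$ (a, b) = (P *\<^sub>v u b) $ a"
      using ab u[OF ab(2)] P'(1) by (auto simp: U_def scalar_prod_def)
    also have "\<dots> = u b $ a * l b" using Pu[OF ab(2)] u[OF ab(2)] ab by simp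
    also have "\<dots> = (\<Sum>k<?n. if k = b then u b $ a * l b else 0)" using ab by simp
    also have "\<dots> = (\<Sum>k<?n. u k $ a * (if k = b then l k else 0))"
      by (rule sum.cong) auto
    also have "\<dots> = (U * D) $$ (a, b)"
      using ab by (simp add: U_def D_def scalar_prod_def atLeast0LessThan)
    finally show "(P * U) $$ (a, b) = (U * D) $$ (a, b)" .
  qed (use carr P'(1) in auto)
  then have "U * D * V = P * (U * V)"
    using assoc_mult_mat[OF P'(1) carr(1,2)] by simp
  then have "P = U * D * V" using UV P'(1) by simp
  then have "similar_mat P D"
    using carr P'(1) UV VU by (intro similar_matI[of _ _ U V ?n]) auto
  then have "char_poly P = char_poly D" by (rule char_poly_similar)
  also have "\<dots> = (\<Prod>a\<leftarrow>diag_mat D. [:- a, 1:])"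
    by (rule char_poly_upper_triangular[OF carr(3)]) (auto simp: D_def)
  also have "diag_mat D = map l [0..<?n]" by (auto simp: diag_mat_def D_def)
  also have "(\<Prod>a\<leftarrow>\<dots>. [:- a, 1:]) = (\<Prod>i<?n. [:- l i, 1:])"
    by (simp add: prod.list_conv_set_nth atLeast0LessThan)
  also have "\<dots> = (\<Prod>i<N. [:- l i, 1:]) * (\<Prod>i<N. [:- l (i + N), 1:])"
    using prod.atLeastLessThan_concat[of 0 N "N + N" "\<lambda>i. [:- l i, 1:]"]
      prod.shift_bounds_nat_ivl[of "\<lambda>i. [:- l i, 1:]" 0 N N]
    by (simp add: atLeast0LessThan mult_2)
  also have "\<dots> = (\<Prod>i<N. [:- t i, 1:]) * (\<Prod>i<N. [:- inverse (t i), 1:])"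
  proof -
    have "cnj (t i) = inverse (t i)" if "i < N" for i
      using unitary_eigenvalue_norm[OF P' v(1)[OF that] _ v(2)[OF that]] v(3)[of i i] that
      by (simp add: inverse_unique)
    then show ?thesis by (simp add: l_def)
  qed
  finally have "char_poly P = (\<Prod>i<N. [:- t i, 1:] * [:- inverse (t i), 1:])"
    by (simp only: prod.distrib)
  moreover have "cmod (t i) = 1" if "i < N" for i
  proof -
    have "t i * cnj (t i) = 1"
      using unitary_eigenvalue_norm[OF P' v(1)[OF that] _ v(2)[OF that]] v(3)[of i i] that by simp
    then have "complex_of_real ((cmod (t i))\<^sup>2) = 1" using complex_norm_square by metis
    then have "(cmod (t i))\<^sup>2 = 1" using of_real_eq_1_iff by blast
    then show ?thesis by (simp add: power2_eq_1_iff) (metis norm_ge_zero not_one_le_zero neg_0_le_iff_le)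
  qed
  ultimately show ?thesis unfolding symplectic_eigenvalues_def by blast
qed

section \<open>The character expansion\<close>

abbreviation laurent_trace :: "nat \<Rightarrow> laurent_poly" where
  "laurent_trace i \<equiv> laurent_var_power i 1 + laurent_var_power i (- 1)"

lemma weyl_numerator_eq_chi_det:
  "weyl_numerator N n =
     (\<Prod>i<N. (laurent_var_power i 1 - laurent_var_power i (- 1)) * newton_coeff N laurent_trace i i)
     * chi_det N laurent_trace (shifted_weight N n)"
proof -
  have "weyl_numerator N n = Determinant.det (Matrix.mat N N (\<lambda>(i, j).
      laurent_var_power i 1 ^ shifted_weight N n j - laurent_var_power i (- 1) ^ shifted_weight N n j))"
    unfolding weyl_numerator_def laurent_var_power_of_nat[symmetric]
    by (intro arg_cong[where f = Determinant.det] eq_matI)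
      (auto simp: shifted_weight_def of_nat_diff algebra_simps)
  also have "\<dots> = (\<Prod>i<N. (laurent_var_power i 1 - laurent_var_power i (- 1)) * newton_coeff N laurent_trace i i)
     * chi_det N laurent_trace (shifted_weight N n)"
    by (rule det_powers_factor) (simp add: laurent_var_power_add[symmetric] laurent_var_power_0)
  finally show ?thesis .
qed

text \<open>The Weyl denominator formula of type C, as the case of the bare staircase.\<close>

lemma weyl_denominator_eq:
  "weyl_denominator N =
     (\<Prod>i<N. (laurent_var_power i 1 - laurent_var_power i (- 1)) * newton_coeff N laurent_trace i i)"
proof -
  have "weyl_denominator N = Determinant.det (Matrix.mat N N (\<lambda>(i, j).
      laurent_var_power i 1 ^ (N - j) - laurent_var_power i (- 1) ^ (N - j)))"
    unfolding weyl_denominator_def laurent_var_power_of_nat[symmetric]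
    by (intro arg_cong[where f = Determinant.det] eq_matI) (auto simp: of_nat_diff)
  also have "\<dots> = (\<Prod>i<N. (laurent_var_power i 1 - laurent_var_power i (- 1)) * newton_coeff N laurent_trace i i)
     * chi_det N laurent_trace (\<lambda>j. N - j)"
    by (rule det_powers_factor) (simp add: laurent_var_power_add[symmetric] laurent_var_power_0)
  finally show ?thesis by (simp add: chi_det_staircase)
qed

lemma weyl_denominator_nonzero: "weyl_denominator N \<noteq> 0"
  unfolding weyl_denominator_eq newton_coeff_def
  using laurent_var_diff_inverse_nonzero laurent_trace_diff_nonzero
  by (auto simp: prod_zero_iff simp del: eq_iff_diff_eq_0)

text \<open>The common prefactor is the denominator, and cancelling it in an integral domain makes
  the quotient unique.\<close>

lemma weyl_character_poly_eq:
  "weyl_character_poly N n = chi_det N laurent_trace (shifted_weight N n)"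
  unfolding weyl_character_poly_def
proof (rule the_equality)
  show "chi_det N laurent_trace (shifted_weight N n) * weyl_denominator N = weyl_numerator N n"
    by (simp add: weyl_numerator_eq_chi_det weyl_denominator_eq mult.commute)
  then show "q = chi_det N laurent_trace (shifted_weight N n)"
    if "q * weyl_denominator N = weyl_numerator N n" for q
    using that weyl_denominator_nonzero[of N] by (metis mult_right_cancel)
qed

section \<open>Specialisation to the eigenvalues of P\<close>

lemma chi_det_laurent_vars_below: "chi_det N laurent_trace m \<in> laurent_vars_below N"
proof -
  have "cheb_diff N laurent_trace k i \<in> laurent_vars_below N" for k i
  proof (induction N "laurent_trace" k arbitrary: i rule: cheb_diff.induct)
    case (3 N m)
    have "laurent_trace i * cheb_diff N laurent_trace (Suc m) i \<in> laurent_vars_below N"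
    \<comment> \<open>For \<open>i \<ge> N\<close> the trace involves a foreign variable, but it is
      multiplied by a vanishing entry.\<close>
    proof (cases "i < N")
      case True
      then show ?thesis
        by (intro laurent_vars_below_mult laurent_vars_below_add laurent_vars_below_var_power 3)
    qed (simp add: cheb_diff_outside laurent_vars_below_const)
    then show ?case using 3
      by (auto simp: newton_op_def intro!: laurent_vars_below_add laurent_vars_below_diff)
  qed (auto simp: laurent_vars_below_const)
  then show ?thesis unfolding chi_det_def by (intro laurent_vars_below_det)
qed

text \<open>Only ring operations occur in \<open>chi_det\<close>, so evaluation passes through it
  even at points where the Weyl denominator vanishes.\<close>

lemma (in comm_ring_hom) hom_chi_det: "hom (chi_det N y m) = chi_det N (\<lambda>i. hom (y i)) m"
proof -
  have "hom (cheb_diff N y k i) = cheb_diff N (\<lambda>i. hom (y i)) k i" for k i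
    by (induction N y k arbitrary: i rule: cheb_diff.induct)
      (simp_all add: newton_op_def hom_minus hom_add hom_mult)
  then have "map_mat hom (Matrix.mat N N (\<lambda>(i, j). cheb_diff N y (m j) i)) =
      Matrix.mat N N (\<lambda>(i, j). cheb_diff N (\<lambda>i. hom (y i)) (m j) i)"
    by (intro eq_matI) auto
  then show ?thesis unfolding chi_det_def hom_det[symmetric] by simp
qed

lemma laurent_eval_weyl_character_poly:
  assumes "\<And>i. i < N \<Longrightarrow> s i = t i" "\<And>i. s i \<noteq> 0"
  shows "laurent_eval (weyl_character_poly N n) t =
    chi_det N (\<lambda>i. s i + inverse (s i)) (shifted_weight N n)"
proof -
  interpret comm_ring_hom "\<lambda>q. laurent_eval q s"
    by (rule comm_ring_hom_laurent_eval) (rule assms)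
  have "laurent_eval (weyl_character_poly N n) t = laurent_eval (weyl_character_poly N n) s"
    by (rule laurent_eval_cong[of _ N])
      (use assms in \<open>auto simp: weyl_character_poly_eq chi_det_laurent_vars_below\<close>)
  then show ?thesis
    by (simp add: weyl_character_poly_eq hom_chi_det laurent_eval_add laurent_eval_var_power
        power_int_minus)
qed

lemma symplectic_eigenvalues_trace:
  assumes "P \<in> carrier_mat (2 * N) (2 * N)" "symplectic_eigenvalues N P t"
  shows "mat_trace P = (\<Sum>i<N. t i + inverse (t i))"
proof -
  let ?es = "map t [0..<N] @ map (\<lambda>i. inverse (t i)) [0..<N]"
  have "(\<Prod>i\<leftarrow>[0..<N]. g i) = (\<Prod>i<N. g i)" for g :: "nat \<Rightarrow> complex poly"
    by (simp add: prod.list_conv_set_nth atLeast0LessThan)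
  then have "char_poly P = (\<Prod>e\<leftarrow>?es. [:- e, 1:])"
    using assms(2)
    by (simp only: symplectic_eigenvalues_def prod.distrib map_append prod_list.append map_map comp_def)
  then have "mat_trace P = sum_list ?es"
    by (rule mat_trace_eq_sum_eigenvalues[OF assms(1)])
  then show ?thesis by (simp add: interv_sum_list_conv_sum_set_nat atLeast0LessThan sum.distrib)
qed

theorem mainTheorem4:
  fixes N :: nat and x :: complex and P :: "complex mat"
  assumes "N \<ge> 1"
    and "P \<in> compact_symplectic_group N"
  shows "((\<lambda>n. Determinant.det (Matrix.mat N N (\<lambda>(i, j).
              bessel_I (int (n ! j) + int i - int j) (2 * x)
              - bessel_I (int (n ! j) + 2 * int N - int i - int j) (2 * x)))
            * symplectic_character N n P)
          has_sum exp (x * mat_trace P)) (dominant_weights N)"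
proof -
  define t where "t = (SOME t. symplectic_eigenvalues N P t)"
  have t: "symplectic_eigenvalues N P t"
    using symplectic_eigenvalues_exist[OF assms(2)] unfolding t_def by (rule someI_ex)
  \<comment> \<open>The coordinates of \<open>t\<close> from \<open>N\<close> on are arbitrary.
    Setting them to 1 makes every coordinate nonzero and gives the bound 2 on \<open>y i\<close> for
    all \<open>i\<close>.\<close>
  define s where "s i = (if i < N then t i else 1)" for i
  define y where "y i = s i + inverse (s i)" for i
  have s: "cmod (s i) = 1" for i
    using t by (simp add: s_def symplectic_eigenvalues_def)
  have "cmod (y i) \<le> 2" for i
    using norm_triangle_ineq[of "s i" "inverse (s i)"] s[of i] by (simp add: y_def norm_inverse)
  from has_sum_exp_chi_det[of y, OF this]
  have "((\<lambda>n. Determinant.det (Matrix.mat N N (\<lambda>(i, j).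
              bessel_I (int (n ! j) + int i - int j) (2 * x)
              - bessel_I (int (n ! j) + 2 * int N - int i - int j) (2 * x)))
            * chi_det N y (shifted_weight N n))
          has_sum exp (x * (\<Sum>i<N. y i))) (dominant_weights N)" .
  moreover have "symplectic_character N n P = chi_det N y (shifted_weight N n)" for n
  proof -
    have "s i \<noteq> 0" for i using s[of i] by auto
    then show ?thesis
      unfolding symplectic_character_def t_def[symmetric] y_def
      by (intro laurent_eval_weyl_character_poly) (auto simp: s_def)
  qed
  moreover have "mat_trace P = (\<Sum>i<N. y i)"
    using symplectic_eigenvalues_trace[OF _ t] assms(2)
    by (auto simp: compact_symplectic_group_def y_def s_def intro!: sum.cong)
  ultimately show ?thesis by simp
qed

end
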